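(* Let $\mathsf A,\mathsf B$ be finite-dimensional complex Hilbert spaces of dimensions $d_{\mathsf A},d_{\mathsf B}$, and $d_{\mathsf{AB}}=d_{\mathsf A}d_{\mathsf B}$. Let $\Theta$ be a completely positive map from operators on $\mathsf A$ to operators on $\mathsf B$ with Kraus representation $\{K_i\}_{i=1}^r$, so that $\Theta(\sigma)=\sum_{i=1}^rK_i\sigma K_i^\dagger$, and let $\hat\rho=\mathfrak C(\Theta)$ be its Choi state (a density matrix). Let $R:=\sum_{i=1}^rK_i^\dagger K_i$ and assume $R>0$. Then $\Pi_{\mathcal C}[\hat\rho]$ is the Choi state of the channel with Kraus operators $\{K_i'=K_iR^{-1/2}\}_{i=1}^r$, and these can be computed (from the $K_i$) in $$O\!\left(r\,d_{\mathsf A}^2d_{\mathsf B}+d_{\mathsf A}^3\right)\ \text{arithmetic operations and}\ O\!\left(r\,d_{\mathsf{AB}}+d_{\mathsf A}^2\right)\ \text{memory},$$ without ever forming a $d_{\mathsf{AB}}\times d_{\mathsf{AB}}$ matrix.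
   Context: The normalized Choi representation is $\mathfrak C(\Theta):=(\mathrm{Id}_{\mathsf A}\otimes\Theta)(|\omega\rangle\langle\omega|)$, $|\omega\rangle=d_{\mathsf A}^{-1/2}\sum_i|i,i\rangle$. For a density matrix $\hat\rho$ on $\mathsf A\otimes\mathsf B$ with $\hat\rho_{\mathsf A}:=\mathrm{Tr}_{\mathsf B}[\hat\rho]>0$, the fidelity projection is $\Pi_{\mathcal C}[\hat\rho]:=\frac1{d_{\mathsf A}}(\hat\rho_{\mathsf A}^{-1/2}\otimes I_{\mathsf B})\hat\rho(\hat\rho_{\mathsf A}^{-1/2}\otimes I_{\mathsf B})$; it is the unique maximizer of the fidelity $\|\hat\rho^{1/2}\sigma^{1/2}\|_1$ over density matrices $\sigma$ on $\mathsf A\otimes\mathsf B$ with $\mathrm{Tr}_{\mathsf B}[\sigma]=I_{\mathsf A}/d_{\mathsf A}$. Cost model: arithmetic on numbers is unit cost and one stored number is unit memory; an eigendecomposition of a $d\times d$ Hermitian matrix costs $O(d^3)$ operations and $O(d^2)$ memory, and matrix products are computed by the standard algorithm.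
   Formalization: The clause "without ever forming a d_AB×d_AB matrix" is claimed only for d_B>1: when d_B=1 the matrix R itself has that size (and for d_A=d_B=1 so do the outputs K_i'). The identity and the time and memory bounds are claimed for all d_B≥1. *)

theory Defs
  imports
    "Jordan_Normal_Form.Schur_Decomposition"
    "HOL-Library.Landau_Symbols"
    "HOL-Library.Monad_Syntax"
begin

section \<open>Matrices and superoperators\<close>

text \<open>The basis vector \<open>|a,b\<rangle>\<close> of a tensor product whose second factor has dimension \<open>n\<close> has index
  \<open>a * n + b\<close>.\<close>

definition hermitian_mat :: "complex mat \<Rightarrow> bool" where
  "hermitian_mat A \<longleftrightarrow> square_mat A \<and> mat_adjoint A = A"

definition unitary_mat :: "complex mat \<Rightarrow> bool" where
  "unitary_mat U \<longleftrightarrow> square_mat U \<and>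
     mat_adjoint U * U = 1\<^sub>m (dim_row U) \<and> U * mat_adjoint U = 1\<^sub>m (dim_row U)"

text \<open>On \<^typ>\<open>complex\<close>, \<open>0 \<le> z\<close> means that \<open>z\<close> is a non-negative real.\<close>

definition psd_mat :: "complex mat \<Rightarrow> bool" where
  "psd_mat A \<longleftrightarrow> hermitian_mat A \<and>
     (\<forall>v \<in> carrier_vec (dim_row A). 0 \<le> (A *\<^sub>v v) \<bullet>c v)"

definition pos_def_mat :: "complex mat \<Rightarrow> bool" where
  "pos_def_mat A \<longleftrightarrow> hermitian_mat A \<and>
     (\<forall>v \<in> carrier_vec (dim_row A). v \<noteq> 0\<^sub>v (dim_row A) \<longrightarrow> 0 < (A *\<^sub>v v) \<bullet>c v)"

definition trace_mat :: "complex mat \<Rightarrow> complex" where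
  "trace_mat A = (\<Sum>i<dim_row A. A $$ (i, i))"

definition density_mat :: "complex mat \<Rightarrow> bool" where
  "density_mat A \<longleftrightarrow> psd_mat A \<and> trace_mat A = 1"

definition sum_mats :: "nat \<Rightarrow> nat \<Rightarrow> nat \<Rightarrow> (nat \<Rightarrow> complex mat) \<Rightarrow> complex mat" where
  "sum_mats m n r F = mat m n (\<lambda>ij. \<Sum>k<r. F k $$ ij)"

definition kron :: "complex mat \<Rightarrow> complex mat \<Rightarrow> complex mat" (infixl "\<otimes>\<^sub>m" 70) where
  "A \<otimes>\<^sub>m B = mat (dim_row A * dim_row B) (dim_col A * dim_col B)
     (\<lambda>(i, j). A $$ (i div dim_row B, j div dim_col B) * B $$ (i mod dim_row B, j mod dim_col B))"

definition partial_trace_B :: "nat \<Rightarrow> nat \<Rightarrow> complex mat \<Rightarrow> complex mat" where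
  "partial_trace_B dA dB X = mat dA dA (\<lambda>(i, j). \<Sum>b<dB. X $$ (i * dB + b, j * dB + b))"

definition spectral_decomp :: "complex mat \<Rightarrow> complex mat \<Rightarrow> real vec \<Rightarrow> bool" where
  "spectral_decomp A U l \<longleftrightarrow>
     U \<in> carrier_mat (dim_row A) (dim_row A) \<and> unitary_mat U \<and> l \<in> carrier_vec (dim_row A) \<and>
     A = U * mat_diag (dim_row A) (\<lambda>i. complex_of_real (l $ i)) * mat_adjoint U"

text \<open>Functional calculus of Hermitian matrices; the result does not depend on the chosen
  decomposition.\<close>

definition herm_fun :: "(real \<Rightarrow> real) \<Rightarrow> complex mat \<Rightarrow> complex mat" where
  "herm_fun f A = (case (SOME (U, l). spectral_decomp A U l) of (U, l) \<Rightarrow>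
     U * mat_diag (dim_row A) (\<lambda>i. complex_of_real (f (l $ i))) * mat_adjoint U)"

definition inv_sqrt_mat :: "complex mat \<Rightarrow> complex mat" where
  "inv_sqrt_mat = herm_fun (\<lambda>x. 1 / sqrt x)"

definition linear_superop :: "nat \<Rightarrow> nat \<Rightarrow> (complex mat \<Rightarrow> complex mat) \<Rightarrow> bool" where
  "linear_superop m n \<Phi> \<longleftrightarrow>
     (\<forall>X \<in> carrier_mat m m. \<Phi> X \<in> carrier_mat n n) \<and>
     (\<forall>X \<in> carrier_mat m m. \<forall>Y \<in> carrier_mat m m. \<Phi> (X + Y) = \<Phi> X + \<Phi> Y) \<and>
     (\<forall>c. \<forall>X \<in> carrier_mat m m. \<Phi> (c \<cdot>\<^sub>m X) = c \<cdot>\<^sub>m \<Phi> X)"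

text \<open>\<open>Id\<^sub>k \<otimes> \<Phi>\<close> applies \<open>\<Phi>\<close> to each of the \<open>k \<times> k\<close> blocks (of size \<open>m \<times> m\<close>) of \<open>X\<close>.\<close>

definition id_tensor ::
  "nat \<Rightarrow> nat \<Rightarrow> nat \<Rightarrow> (complex mat \<Rightarrow> complex mat) \<Rightarrow> complex mat \<Rightarrow> complex mat" where
  "id_tensor k m n \<Phi> X = mat (k * n) (k * n) (\<lambda>(p, q).
     \<Phi> (mat m m (\<lambda>(i, j). X $$ ((p div n) * m + i, (q div n) * m + j))) $$ (p mod n, q mod n))"

definition completely_positive :: "nat \<Rightarrow> nat \<Rightarrow> (complex mat \<Rightarrow> complex mat) \<Rightarrow> bool" where
  "completely_positive m n \<Phi> \<longleftrightarrow> linear_superop m n \<Phi> \<and>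
     (\<forall>k. \<forall>X \<in> carrier_mat (k * m) (k * m). psd_mat X \<longrightarrow> psd_mat (id_tensor k m n \<Phi> X))"

definition quantum_channel :: "nat \<Rightarrow> nat \<Rightarrow> (complex mat \<Rightarrow> complex mat) \<Rightarrow> bool" where
  "quantum_channel m n \<Phi> \<longleftrightarrow> completely_positive m n \<Phi> \<and>
     (\<forall>X \<in> carrier_mat m m. trace_mat (\<Phi> X) = trace_mat X)"

definition max_entangled :: "nat \<Rightarrow> complex vec" where
  "max_entangled d = vec (d * d)
     (\<lambda>k. if k div d = k mod d then complex_of_real (1 / sqrt (real d)) else 0)"

definition ketbra :: "complex vec \<Rightarrow> complex mat" where
  "ketbra v = mat (dim_vec v) (dim_vec v) (\<lambda>(i, j). v $ i * cnj (v $ j))"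

definition choi :: "nat \<Rightarrow> nat \<Rightarrow> (complex mat \<Rightarrow> complex mat) \<Rightarrow> complex mat" where
  "choi dA dB \<Theta> = id_tensor dA dA dB \<Theta> (ketbra (max_entangled dA))"

definition fidelity_projection :: "nat \<Rightarrow> nat \<Rightarrow> complex mat \<Rightarrow> complex mat" where
  "fidelity_projection dA dB \<rho> =
     (let S = inv_sqrt_mat (partial_trace_B dA dB \<rho>) \<otimes>\<^sub>m 1\<^sub>m dB
      in (1 / of_nat dA) \<cdot>\<^sub>m (S * \<rho> * S))"

definition kraus_map :: "nat \<Rightarrow> nat \<Rightarrow> (nat \<Rightarrow> complex mat) \<Rightarrow> complex mat \<Rightarrow> complex mat" where
  "kraus_map dB r K \<sigma> = sum_mats dB dB r (\<lambda>i. K i * \<sigma> * mat_adjoint (K i))"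

definition kraus_R :: "nat \<Rightarrow> nat \<Rightarrow> (nat \<Rightarrow> complex mat) \<Rightarrow> complex mat" where
  "kraus_R dA r K = sum_mats dA dA r (\<lambda>i. mat_adjoint (K i) * K i)"

definition normalized_kraus :: "nat \<Rightarrow> nat \<Rightarrow> (nat \<Rightarrow> complex mat) \<Rightarrow> nat \<Rightarrow> complex mat" where
  "normalized_kraus dA r K i = K i * inv_sqrt_mat (kraus_R dA r K)"

definition kraus_instance ::
  "nat \<Rightarrow> nat \<Rightarrow> nat \<Rightarrow> (nat \<Rightarrow> complex mat) \<Rightarrow> (complex mat \<Rightarrow> complex mat) \<Rightarrow> bool" where
  "kraus_instance dA dB r K \<Theta> \<longleftrightarrow>
     0 < dA \<and> 0 < dB \<and>
     completely_positive dA dB \<Theta> \<and>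
     (\<forall>i<r. K i \<in> carrier_mat dB dA) \<and>
     (\<forall>\<sigma> \<in> carrier_mat dA dA. \<Theta> \<sigma> = kraus_map dB r K \<sigma>) \<and>
     density_mat (choi dA dB \<Theta>) \<and>
     pos_def_mat (kraus_R dA r K)"


section \<open>Programs and their cost\<close>

text \<open>
  A program works on a store of matrices of numbers, which it accesses entry by entry, and on index
  variables holding natural numbers. A matrix is addressed by a name and a slot, so that families
  such as \<open>K\<^sub>0, K\<^sub>1, \<dots>\<close> can be traversed by a loop. The only operation on whole matrices, besides
  creating a zero matrix, is the Hermitian eigendecomposition: matrix products have to be
  programmed with loops over scalar operations.
\<close>

datatype iexp = IConst nat | IVar nat

type_synonym mref = "nat \<times> iexp"

datatype nexp =
    NConst int
  | NCell mref iexp iexp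
  | NAdd nexp nexp
  | NSub nexp nexp
  | NMul nexp nexp
  | NDiv nexp nexp
  | NConj nexp
  | NSqrt nexp

text \<open>\<open>Eig a u w\<close> decomposes the matrix \<open>a\<close> and creates two new matrices: \<open>u\<close>, whose columns are the
  eigenvectors, and the column \<open>w\<close> of eigenvalues.\<close>

datatype com =
    Seq com com
  | For nat iexp com
  | New mref iexp iexp
  | Assign mref iexp iexp nexp
  | Eig mref mref mref

text \<open>
  Matrices are never discarded, so the final store contains every matrix formed during the
  run. \<open>ops\<close> counts the operations executed so far; \<open>scratch\<close> is the largest amount of temporary
  memory that a single instruction has needed.
\<close>

record state =
  idx :: "nat \<Rightarrow> nat option"
  store :: "nat \<times> nat \<Rightarrow> complex mat option"
  ops :: nat
  scratch :: nat

primrec ieval :: "state \<Rightarrow> iexp \<Rightarrow> nat option" where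
  "ieval s (IConst n) = Some n"
| "ieval s (IVar x) = idx s x"

definition address :: "state \<Rightarrow> mref \<Rightarrow> (nat \<times> nat) option" where
  "address s a = map_option (Pair (fst a)) (ieval s (snd a))"

definition in_bounds :: "complex mat \<Rightarrow> nat \<Rightarrow> nat \<Rightarrow> bool" where
  "in_bounds A i j \<longleftrightarrow> i < dim_row A \<and> j < dim_col A"

text \<open>Division by zero and the square root of anything but a non-negative real are errors.\<close>

primrec neval :: "state \<Rightarrow> nexp \<Rightarrow> complex option" where
  "neval s (NConst c) = Some (of_int c)"
| "neval s (NCell a i j) = do {
     k \<leftarrow> address s a; A \<leftarrow> store s k; p \<leftarrow> ieval s i; q \<leftarrow> ieval s j;
     if in_bounds A p q then Some (A $$ (p, q)) else None }"
| "neval s (NAdd e f) = do { x \<leftarrow> neval s e; y \<leftarrow> neval s f; Some (x + y) }"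
| "neval s (NSub e f) = do { x \<leftarrow> neval s e; y \<leftarrow> neval s f; Some (x - y) }"
| "neval s (NMul e f) = do { x \<leftarrow> neval s e; y \<leftarrow> neval s f; Some (x * y) }"
| "neval s (NDiv e f) = do { x \<leftarrow> neval s e; y \<leftarrow> neval s f; if y = 0 then None else Some (x / y) }"
| "neval s (NConj e) = do { x \<leftarrow> neval s e; Some (cnj x) }"
| "neval s (NSqrt e) = do { x \<leftarrow> neval s e;
     if x \<in> \<real> \<and> 0 \<le> Re x then Some (complex_of_real (sqrt (Re x))) else None }"

text \<open>The number of constants, memory accesses and arithmetic operations in an expression; it also
  bounds the number of intermediate values.\<close>

primrec ncost :: "nexp \<Rightarrow> nat" where
  "ncost (NConst c) = 1"
| "ncost (NCell a i j) = 1"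
| "ncost (NAdd e f) = ncost e + ncost f + 1"
| "ncost (NSub e f) = ncost e + ncost f + 1"
| "ncost (NMul e f) = ncost e + ncost f + 1"
| "ncost (NDiv e f) = ncost e + ncost f + 1"
| "ncost (NConj e) = ncost e + 1"
| "ncost (NSqrt e) = ncost e + 1"

definition charge :: "nat \<Rightarrow> nat \<Rightarrow> state \<Rightarrow> state" where
  "charge t m s = s\<lparr>ops := ops s + t, scratch := max (scratch s) m\<rparr>"

definition column_mat :: "real vec \<Rightarrow> complex mat" where
  "column_mat l = mat (dim_vec l) 1 (\<lambda>(i, _). complex_of_real (l $ i))"

text \<open>
  The parameters \<open>eig\<close>, \<open>T\<close>, \<open>M\<close> are the eigendecomposition routine and its numbers of operations and
  of memory cells as functions of the dimension. The result \<^const>\<open>None\<close> signals a run-time error: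
  an undefined variable or matrix, an index out of bounds, a matrix created twice, an arithmetic
  error, or an eigendecomposition of a matrix that is not Hermitian.
\<close>

primrec exec ::
  "(complex mat \<Rightarrow> complex mat \<times> real vec) \<Rightarrow> (nat \<Rightarrow> nat) \<Rightarrow> (nat \<Rightarrow> nat) \<Rightarrow>
   com \<Rightarrow> state \<Rightarrow> state option" where
  "exec eig T M (Seq c d) s = do { s' \<leftarrow> exec eig T M c s; exec eig T M d s' }"
| "exec eig T M (For x b c) s = do {
     n \<leftarrow> ieval s b;
     foldl (\<lambda>t i. do { s' \<leftarrow> t; exec eig T M c (charge 1 0 (s'\<lparr>idx := (idx s')(x \<mapsto> i)\<rparr>)) })
       (Some (charge 1 0 s)) [0..<n] }"
| "exec eig T M (New a m n) s = do {
     k \<leftarrow> address s a; p \<leftarrow> ieval s m; q \<leftarrow> ieval s n;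
     if store s k = None
     then Some (charge (p * q + 1) 0 (s\<lparr>store := (store s)(k \<mapsto> 0\<^sub>m p q)\<rparr>))
     else None }"
| "exec eig T M (Assign a i j e) s = do {
     k \<leftarrow> address s a; A \<leftarrow> store s k; p \<leftarrow> ieval s i; q \<leftarrow> ieval s j; x \<leftarrow> neval s e;
     if in_bounds A p q
     then Some (charge (ncost e + 1) (ncost e)
            (s\<lparr>store := (store s)(k \<mapsto> update_mat A (p, q) x)\<rparr>))
     else None }"
| "exec eig T M (Eig a u w) s = do {
     k \<leftarrow> address s a; ku \<leftarrow> address s u; kw \<leftarrow> address s w; A \<leftarrow> store s k;
     if hermitian_mat A \<and> ku \<noteq> kw \<and> store s ku = None \<and> store s kw = None
     then (case eig A of (U, l) \<Rightarrow>
       Some (charge (T (dim_row A)) (M (dim_row A))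
         (s\<lparr>store := (store s)(ku \<mapsto> U, kw \<mapsto> column_mat l)\<rparr>)))
     else None }"

definition eigensolver ::
  "(complex mat \<Rightarrow> complex mat \<times> real vec) \<Rightarrow> (nat \<Rightarrow> nat) \<Rightarrow> (nat \<Rightarrow> nat) \<Rightarrow> bool" where
  "eigensolver eig T M \<longleftrightarrow>
     (\<forall>A. hermitian_mat A \<longrightarrow> (case eig A of (U, l) \<Rightarrow> spectral_decomp A U l)) \<and>
     (\<lambda>d. real (T d)) \<in> O(\<lambda>d. real d ^ 3) \<and>
     (\<lambda>d. real (M d)) \<in> O(\<lambda>d. real d ^ 2)"

text \<open>The index variables and the matrices are created once and kept, so the final state accounts
  for the peak number of stored numbers, input and output included.\<close>

definition memory :: "state \<Rightarrow> nat" where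
  "memory s = card (dom (idx s)) +
     (\<Sum>k \<in> dom (store s). dim_row (the (store s k)) * dim_col (the (store s k))) + scratch s"

text \<open>Input: the dimensions in the index variables 0, 1, 2 and the Kraus operators under the matrix
  name 0. Output: under the matrix name 1.\<close>

definition input_state :: "nat \<Rightarrow> nat \<Rightarrow> nat \<Rightarrow> (nat \<Rightarrow> complex mat) \<Rightarrow> state" where
  "input_state dA dB r K = \<lparr>
     idx = [0 \<mapsto> dA, 1 \<mapsto> dB, 2 \<mapsto> r],
     store = (\<lambda>(a, i). if a = 0 \<and> i < r then Some (K i) else None),
     ops = 0, scratch = 0\<rparr>"

definition output_is :: "state \<Rightarrow> nat \<Rightarrow> (nat \<Rightarrow> complex mat) \<Rightarrow> bool" where
  "output_is s r L \<longleftrightarrow> (\<forall>i<r. store s (1, i) = Some (L i))"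

end

theory Submission
  imports Defs
begin

text \<open>
  A Kraus family with \<open>R = \<Sum>\<^sub>i K\<^sub>i\<^sup>\<dagger> K\<^sub>i\<close> has the Choi matrix \<open>\<rho> = d\<inverse> \<Sum>\<^sub>i |K\<^sub>i\<rangle>\<langle>K\<^sub>i|\<close>, where
  \<open>|K\<rangle> = \<Sum>\<^sub>a |a\<rangle> \<otimes> K|a\<rangle>\<close>. Hence its partial trace is \<open>d\<inverse> R\<^sup>T\<close>, whose inverse square root is
  \<open>\<surd>d (R\<^sup>-\<^sup>1\<^sup>/\<^sup>2)\<^sup>T\<close>, and \<open>(G\<^sup>T \<otimes> I) |K\<rangle> = |K G\<rangle>\<close> for every \<open>G\<close>. With \<open>G = R\<^sup>-\<^sup>1\<^sup>/\<^sup>2\<close> the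
  fidelity projection therefore replaces each \<open>K\<^sub>i\<close> by \<open>K\<^sub>i G\<close>, and \<open>G R G = I\<close> makes the new family
  trace preserving. Only \<open>R\<close>, its eigendecomposition \<open>U diag(l) U\<^sup>\<dagger>\<close>, \<open>G = U diag(l\<^sup>-\<^sup>1\<^sup>/\<^sup>2) U\<^sup>\<dagger>\<close>
  and the products \<open>K\<^sub>i G\<close> have to be computed.
\<close>

section \<open>Adjoints and products\<close>

text \<open>Three decompositions meet: the one that \<open>herm_fun\<close> picks by
  \<open>SOME\<close> for R, the one it picks for the reduced state, and the one that
  \<open>eig\<close> returns at run time. Nothing relates them a priori, so independence of the
  functional calculus from the decomposition is the pivot. It yields the law for \<open>c\<close>
  times a transpose, and it identifies the computed matrix with \<open>inv_sqrt_mat R\<close>.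

  The factors of d balance as follows: the two copies of sqrt d in the conjugating matrices cancel
  the 1/d inside the Choi matrix, and the 1/d in front of the projection becomes the normalisation
  of the new Choi matrix.

  The cost is derived in a logic of Hoare triples with a time bound, where a loop nest costs a
  product of its bounds. This product form needs all bounds to be positive, including r, which is
  forced by R > 0. As stores only grow, peak memory and the absence of large matrices can be read
  off the final store.\<close>

lemma mat_adjoint_dim [simp]:
  "dim_row (mat_adjoint A) = dim_col A" "dim_col (mat_adjoint A) = dim_row A"
  by (simp_all add: mat_adjoint_def mat_of_rows_def)

lemma mat_adjoint_carrier [simp]:
  "A \<in> carrier_mat m n \<Longrightarrow> mat_adjoint A \<in> carrier_mat n m"
  by auto

lemma mat_adjoint_index [simp]:
  fixes A :: "complex mat"
  shows "i < dim_col A \<Longrightarrow> j < dim_row A \<Longrightarrow> mat_adjoint A $$ (i, j) = cnj (A $$ (j, i))"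
  by (simp add: mat_adjoint_def mat_of_rows_def)

lemma mat_adjoint_adjoint [simp]: "mat_adjoint (mat_adjoint A) = (A :: complex mat)"
  by (rule eq_matI) auto

lemma mat_mult_index:
  assumes "A \<in> carrier_mat m n" "B \<in> carrier_mat n p" "i < m" "j < p"
  shows "(A * B) $$ (i, j) = (\<Sum>k<n. A $$ (i, k) * B $$ (k, j))"
  using assms by (auto simp: scalar_prod_def lessThan_atLeast0)

lemma mat_mult_index3:
  fixes A :: "'a :: comm_semiring_0 mat"
  assumes "A \<in> carrier_mat m n" "B \<in> carrier_mat n p" "C \<in> carrier_mat p q" "i < m" "j < q"
  shows "(A * B * C) $$ (i, j) = (\<Sum>k<n. \<Sum>l<p. A $$ (i, k) * B $$ (k, l) * C $$ (l, j))"
proof -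
  have "(A * B * C) $$ (i, j) = (\<Sum>l<p. (\<Sum>k<n. A $$ (i, k) * B $$ (k, l)) * C $$ (l, j))"
    using assms
    by (subst mat_mult_index[where m = m and n = p and p = q])
      (auto intro!: sum.cong simp: mat_mult_index[where m = m and n = n and p = p] simp del: index_mult_mat)
  also have "\<dots> = (\<Sum>k<n. \<Sum>l<p. A $$ (i, k) * B $$ (k, l) * C $$ (l, j))"
    by (subst sum.swap) (simp add: sum_distrib_right)
  finally show ?thesis .
qed

lemma mat_adjoint_mult:
  fixes A :: "complex mat"
  assumes "A \<in> carrier_mat m n" "B \<in> carrier_mat n p"
  shows "mat_adjoint (A * B) = mat_adjoint B * mat_adjoint A"
  using assms by (intro eq_matI) (auto simp: scalar_prod_def mult.commute intro!: sum.cong)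

lemma mat_adjoint_mult3:
  fixes A :: "complex mat"
  assumes "A \<in> carrier_mat m n" "B \<in> carrier_mat n p" "C \<in> carrier_mat p q"
  shows "mat_adjoint (A * B * C) = mat_adjoint C * mat_adjoint B * mat_adjoint A"
proof -
  have "mat_adjoint (A * B * C) = mat_adjoint C * (mat_adjoint B * mat_adjoint A)"
    using assms by (simp only: mat_adjoint_mult[OF mult_carrier_mat] mat_adjoint_mult[of A m n B p])
  thus ?thesis
    using assms by (simp add: assoc_mult_mat[of "mat_adjoint C" q p "mat_adjoint B" n "mat_adjoint A" m])
qed

lemma hermitian_matD:
  assumes "hermitian_mat A" "A \<in> carrier_mat n n" "i < n" "j < n"
  shows "cnj (A $$ (i, j)) = A $$ (j, i)"
  using assms mat_adjoint_index[of j A i] by (auto simp: hermitian_mat_def)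

lemma hermitian_matI:
  assumes "A \<in> carrier_mat n n" "\<And>i j. i < n \<Longrightarrow> j < n \<Longrightarrow> cnj (A $$ (i, j)) = A $$ (j, i)"
  shows "hermitian_mat A"
  using assms by (auto simp: hermitian_mat_def intro!: eq_matI)

lemma unitary_matD:
  assumes "unitary_mat U" "U \<in> carrier_mat n n"
  shows "mat_adjoint U * U = 1\<^sub>m n" "U * mat_adjoint U = 1\<^sub>m n"
  using assms by (auto simp: unitary_mat_def)

text \<open>In finite dimension a left inverse of a square matrix is also a right inverse, so one of
  the two identities suffices.\<close>

lemma unitary_matI:
  assumes "U \<in> carrier_mat n n" "mat_adjoint U * U = 1\<^sub>m n"
  shows "unitary_mat U"
proof -
  have "U * mat_adjoint U = 1\<^sub>m n"
    using assms mat_mult_left_right_inverse[of "mat_adjoint U" n U] by simp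
  with assms show ?thesis by (auto simp: unitary_mat_def)
qed

lemma unitary_mat_mult:
  assumes U: "unitary_mat U" "U \<in> carrier_mat n n" and V: "unitary_mat V" "V \<in> carrier_mat n n"
  shows "unitary_mat (U * V)"
proof (rule unitary_matI[of _ n])
  have "mat_adjoint (U * V) * (U * V) = mat_adjoint V * ((mat_adjoint U * U) * V)"
    using U V by (simp add: mat_adjoint_mult[of U n n V n] assoc_mult_mat[of _ n n _ n _ n])
  also have "\<dots> = 1\<^sub>m n"
    using unitary_matD[OF U] unitary_matD[OF V] V by simp
  finally show "mat_adjoint (U * V) * (U * V) = 1\<^sub>m n" .
qed (use U V in auto)

section \<open>The spectral theorem\<close>

text \<open>Over the complex numbers the characteristic polynomial splits, so an eigenvector exists.
  It is completed to a basis and orthogonalised; Gram-Schmidt keeps the first vector, so after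
  normalisation column 0 is still an eigenvector.\<close>

lemma unitary_with_eigenvector:
  fixes A :: "complex mat"
  assumes A: "A \<in> carrier_mat n n" and n: "0 < n"
  obtains U e where "U \<in> carrier_mat n n" "unitary_mat U" "A *\<^sub>v col U 0 = e \<cdot>\<^sub>v col U 0"
proof -
  interpret cof_vec_space n "TYPE(complex)" .
  obtain es where es: "char_poly A = (\<Prod>a\<leftarrow>es. [:- a, 1:])" "length es = n"
    using char_poly_factorized[OF A] by blast
  then obtain e es' where "es = e # es'" using n by (cases es) auto
  hence "poly (char_poly A) e = 0" by (simp add: es(1))
  hence "eigenvalue A e" using eigenvalue_root_char_poly[OF A] by simp
  then obtain v where ev: "eigenvector A v e" unfolding eigenvalue_def by blast
  hence v: "v \<in> carrier_vec n" "v \<noteq> 0\<^sub>v n" "A *\<^sub>v v = e \<cdot>\<^sub>v v"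
    using A by (auto simp: eigenvector_def)
  define b where "b = basis_completion v"
  note bc = basis_completion[OF v(1,2), folded b_def]
  define ws where "ws = gram_schmidt n b"
  from gram_schmidt_result[OF bc(2,4,5) ws_def]
  have ws: "set ws \<subseteq> carrier_vec n" "corthogonal ws" "length ws = n" using bc(6) by auto
  have ws0: "ws ! 0 = v"
  proof -
    obtain vs where "b = v # vs" using bc(6,7) n by (cases b) auto
    hence "hd ws = v" using gram_schmidt_hd[OF v(1), of vs] by (simp add: ws_def)
    thus ?thesis using ws(3) n by (cases ws) auto
  qed
  have wsi: "ws ! i \<in> carrier_vec n" if "i < n" for i using ws that by (auto simp: subset_iff)
  \<comment> \<open>\<open>corthogonal\<close> gives orthogonality and nonzero self products but not
    unit length, so each vector is divided by its norm.\<close>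
  define nrm where "nrm i = sqrt (Re (ws ! i \<bullet>c ws ! i))" for i
  have sq: "ws ! i \<bullet>c ws ! i = complex_of_real (nrm i) ^ 2 \<and> nrm i > 0" if i: "i < n" for i
  proof -
    have "ws ! i \<bullet>c ws ! i \<noteq> 0"
      using corthogonalD[OF ws(2), of i i] i ws(3) by auto
    moreover have "0 \<le> ws ! i \<bullet>c ws ! i" by (rule conjugate_square_ge_0_vec)
    ultimately have "Re (ws ! i \<bullet>c ws ! i) > 0" "Im (ws ! i \<bullet>c ws ! i) = 0"
      by (auto simp: less_eq_complex_def complex_eq_iff)
    thus ?thesis by (auto simp: nrm_def complex_eq_iff simp flip: of_real_power)
  qed
  define U where "U = mat n n (\<lambda>(i, j). (ws ! j) $ i / complex_of_real (nrm j))"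
  have U: "U \<in> carrier_mat n n" by (simp add: U_def)
  have col: "col U j = (1 / complex_of_real (nrm j)) \<cdot>\<^sub>v ws ! j" if "j < n" for j
    using that wsi[OF that] by (intro eq_vecI) (auto simp: U_def)
  have "mat_adjoint U * U = 1\<^sub>m n"
  proof (rule eq_matI)
    fix i j assume "i < dim_row (1\<^sub>m n :: complex mat)" "j < dim_col (1\<^sub>m n :: complex mat)"
    hence i: "i < n" and j: "j < n" by auto
    have "(mat_adjoint U * U) $$ (i, j) = (\<Sum>k<n. cnj (U $$ (k, i)) * U $$ (k, j))"
      using U i j by (subst mat_mult_index[of _ n n _ n]) auto
    also have "\<dots> = (\<Sum>k<n. ws ! j $ k * cnj (ws ! i $ k)) / (complex_of_real (nrm i) * complex_of_real (nrm j))"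
      using i j by (simp add: U_def sum_divide_distrib mult.commute)
    \<comment> \<open>The scalar product conjugates its second argument, hence the order j,
      i.\<close>
    also have "(\<Sum>k<n. ws ! j $ k * cnj (ws ! i $ k)) = ws ! j \<bullet>c ws ! i"
      using wsi[OF i] by (auto simp: scalar_prod_def lessThan_atLeast0)
    also have "\<dots> / (complex_of_real (nrm i) * complex_of_real (nrm j)) = (if i = j then 1 else 0)"
      using corthogonalD[OF ws(2), of j i] i j ws(3) sq[OF i] by (auto simp: power2_eq_square)
    finally show "(mat_adjoint U * U) $$ (i, j) = 1\<^sub>m n $$ (i, j)" using i j by simp
  qed (use U in auto)
  hence "unitary_mat U" using unitary_matI[OF U] by blast
  moreover have "A *\<^sub>v col U 0 = e \<cdot>\<^sub>v col U 0"
    using v A n col[OF n] by (simp add: ws0 mult_mat_vec[OF A v(1)] smult_smult_assoc mult.commute)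
  ultimately show ?thesis using that U by blast
qed

lemma mat_adjoint_four_block:
  fixes A :: "complex mat"
  assumes "A \<in> carrier_mat a c" "B \<in> carrier_mat a d" "C \<in> carrier_mat b c" "D \<in> carrier_mat b d"
  shows "mat_adjoint (four_block_mat A B C D) =
    four_block_mat (mat_adjoint A) (mat_adjoint C) (mat_adjoint B) (mat_adjoint D)"
  using assms by (intro eq_matI) auto

lemma hermitian_congruence:
  assumes A: "hermitian_mat A" "A \<in> carrier_mat n n" and V: "V \<in> carrier_mat m n"
  shows "hermitian_mat (V * A * mat_adjoint V)"
  using assms by (auto simp: hermitian_mat_def mat_adjoint_mult3[of V m n A n "mat_adjoint V" m])

text \<open>Deflation, by induction on the dimension. In a basis that starts with an eigenvector,
  column 0 is e times a unit vector; Hermiticity carries the zeros over to row 0 and makes e real.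
  What remains is a Hermitian block of one dimension less.\<close>

lemma spectral_theorem:
  assumes "hermitian_mat A"
  shows "\<exists>U l. spectral_decomp A U l"
  using assms
proof (induction "dim_row A" arbitrary: A)
  case 0
  hence A: "A \<in> carrier_mat 0 0" by (auto simp: hermitian_mat_def)
  show ?case
    by (rule exI[of _ "1\<^sub>m 0"], rule exI[of _ "0\<^sub>v 0"])
      (use A in \<open>auto simp: spectral_decomp_def unitary_mat_def intro!: eq_matI\<close>)
next
  case (Suc n)
  have A: "A \<in> carrier_mat (Suc n) (Suc n)" using Suc by (auto simp: hermitian_mat_def)
  obtain U e where U: "U \<in> carrier_mat (Suc n) (Suc n)" "unitary_mat U"
    and e: "A *\<^sub>v col U 0 = e \<cdot>\<^sub>v col U 0"
    by (rule unitary_with_eigenvector[OF A]) auto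
  note UU = unitary_matD[OF U(2,1)]
  define A' where "A' = mat_adjoint U * A * U"
  have A': "A' \<in> carrier_mat (Suc n) (Suc n)" using U A by (auto simp: A'_def)
  have hA': "hermitian_mat A'"
    using hermitian_congruence[OF Suc.prems A, of "mat_adjoint U" "Suc n"] U by (simp add: A'_def)
  have A_eq: "A = U * A' * mat_adjoint U"
  proof -
    have "U * A' * mat_adjoint U = (U * mat_adjoint U) * A * (U * mat_adjoint U)"
      using U A by (simp add: A'_def assoc_mult_mat[of _ "Suc n" "Suc n" _ "Suc n" _ "Suc n"]
          mult_carrier_mat[of _ "Suc n" "Suc n" _ "Suc n"])
    thus ?thesis using UU A by simp
  qed
  have col0: "A' $$ (i, 0) = (if i = 0 then e else 0)" if i: "i < Suc n" for i
  proof -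
    have "A' = mat_adjoint U * (A * U)"
      using U A by (simp add: A'_def assoc_mult_mat[of _ "Suc n" "Suc n" _ "Suc n" _ "Suc n"])
    hence "col A' 0 = mat_adjoint U *\<^sub>v col (A * U) 0"
      using U A by (simp only:) (rule col_mult2[of _ "Suc n" "Suc n" _ "Suc n"], auto)
    also have "col (A * U) 0 = e \<cdot>\<^sub>v col U 0"
      using U A by (subst e[symmetric]) (rule col_mult2[of _ "Suc n" "Suc n" _ "Suc n"], auto)
    also have "mat_adjoint U *\<^sub>v (e \<cdot>\<^sub>v col U 0) = e \<cdot>\<^sub>v (mat_adjoint U *\<^sub>v col U 0)"
      using U by (intro mult_mat_vec[of _ "Suc n" "Suc n"] carrier_vecI) auto
    also have "mat_adjoint U *\<^sub>v col U 0 = col (mat_adjoint U * U) 0"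
      using U by (intro col_mult2[symmetric, of _ "Suc n" "Suc n" _ "Suc n"]) auto
    finally have "col A' 0 $ i = (if i = 0 then e else 0)"
      using i by (simp add: UU)
    thus ?thesis using A' i by simp
  qed
  have row0: "A' $$ (0, j) = (if j = 0 then e else 0)" if j: "j < Suc n" for j
    using hermitian_matD[OF hA' A' j, of 0] col0[OF j] col0[of 0] hermitian_matD[OF hA' A', of 0 0]
    by (auto split: if_splits)
  have re: "e = complex_of_real (Re e)"
    using hermitian_matD[OF hA' A', of 0 0] col0[of 0] by (simp add: complex_eq_iff)
  define B where "B = mat n n (\<lambda>(i, j). A' $$ (Suc i, Suc j))"
  have B: "B \<in> carrier_mat n n" by (simp add: B_def)
  have "hermitian_mat B"
    by (rule hermitian_matI[OF B]) (simp add: B_def hermitian_matD[OF hA' A'])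
  moreover have "n = dim_row B" by (simp add: B_def)
  ultimately obtain V l where V: "spectral_decomp B V l" using Suc.hyps(1) by blast
  hence Vc: "V \<in> carrier_mat n n" "unitary_mat V" and l: "l \<in> carrier_vec n"
    and B_eq: "B = V * mat_diag n (\<lambda>i. complex_of_real (l $ i)) * mat_adjoint V"
    using B by (auto simp: spectral_decomp_def)
  note VV = unitary_matD[OF Vc(2,1)]
  define E where "E = mat 1 1 (\<lambda>_. complex_of_real (Re e))"
  have E: "E \<in> carrier_mat 1 1" by (simp add: E_def)
  \<comment> \<open>W is the direct sum of 1 and V. It diagonalises \<open>A'\<close>, so
    \<open>U * W\<close> diagonalises A.\<close>
  define W where "W = four_block_mat (1\<^sub>m 1) (0\<^sub>m 1 n) (0\<^sub>m n 1) V"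
  define D where "D = mat_diag n (\<lambda>i. complex_of_real (l $ i))"
  have D: "D \<in> carrier_mat n n" by (simp add: D_def)
  define l' where "l' = vec (Suc n) (\<lambda>i. if i = 0 then Re e else l $ (i - 1))"
  have diag: "mat_diag (Suc n) (\<lambda>i. complex_of_real (l' $ i)) = four_block_mat E (0\<^sub>m 1 n) (0\<^sub>m n 1) D"
    by (rule eq_matI) (auto simp: mat_diag_def D_def E_def l'_def)
  have W: "W \<in> carrier_mat (Suc n) (Suc n)" using Vc by (intro carrier_matI) (simp_all add: W_def)
  have W_adj: "mat_adjoint W = four_block_mat (1\<^sub>m 1) (0\<^sub>m 1 n) (0\<^sub>m n 1) (mat_adjoint V)"
  proof -
    have "mat_adjoint (0\<^sub>m 1 n :: complex mat) = 0\<^sub>m n 1" "mat_adjoint (0\<^sub>m n 1 :: complex mat) = 0\<^sub>m 1 n"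
      "mat_adjoint (1\<^sub>m 1 :: complex mat) = 1\<^sub>m 1"
      by (auto intro!: eq_matI)
    thus ?thesis
      using Vc unfolding W_def by (subst mat_adjoint_four_block[of _ 1 1 _ n _ n]) auto
  qed
  have "mat_adjoint W * W = four_block_mat (1\<^sub>m 1) (0\<^sub>m 1 n) (0\<^sub>m n 1) (1\<^sub>m n)"
    unfolding W_adj unfolding W_def
    by (subst mult_four_block_mat[of _ 1 1 _ n _ n]) (use Vc VV in auto)
  also have "\<dots> = 1\<^sub>m (Suc n)" by (rule eq_matI) auto
  finally have WU: "unitary_mat W" using unitary_matI[OF W] by blast
  have "W * four_block_mat E (0\<^sub>m 1 n) (0\<^sub>m n 1) D * mat_adjoint W
      = four_block_mat E (0\<^sub>m 1 n) (0\<^sub>m n 1) B"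
    unfolding W_adj unfolding W_def
    by (subst mult_four_block_mat[of _ 1 1 _ n _ n]; (subst mult_four_block_mat[of _ 1 1 _ n _ n])?)
      (use Vc D E in \<open>auto simp: B_eq[folded D_def] mult_carrier_mat[of V n n D n]\<close>)
  also have "\<dots> = A'"
    by (rule eq_matI) (use A' col0 row0 re in \<open>auto simp: E_def B_def\<close>)
  finally have A'_eq: "W * mat_diag (Suc n) (\<lambda>i. complex_of_real (l' $ i)) * mat_adjoint W = A'"
    by (simp add: diag)
  have "A = (U * W) * mat_diag (Suc n) (\<lambda>i. complex_of_real (l' $ i)) * mat_adjoint (U * W)"
    using U W by (simp add: mat_adjoint_mult[of U "Suc n" "Suc n" W "Suc n"]
        assoc_mult_mat[of _ "Suc n" "Suc n" _ "Suc n" _ "Suc n"]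
        mult_carrier_mat[of _ "Suc n" "Suc n" _ "Suc n"] A_eq[folded A'_eq])
  moreover have "unitary_mat (U * W)" using unitary_mat_mult U W WU by blast
  ultimately have "spectral_decomp A (U * W) l'"
    using A U W unfolding spectral_decomp_def by (auto simp: l'_def)
  thus ?case by blast
qed

section \<open>Independence of the functional calculus from the decomposition\<close>

text \<open>The unitary \<open>W = V\<^sup>\<dagger> U\<close> intertwines the two diagonal
  matrices. It can therefore only connect equal eigenvalues, and so it also intertwines their images
  under f.\<close>

lemma spectral_decomp_unique:
  assumes U: "spectral_decomp A U l" and V: "spectral_decomp A V m"
  shows "U * mat_diag (dim_row A) (\<lambda>i. complex_of_real (f (l $ i))) * mat_adjoint U =
    V * mat_diag (dim_row A) (\<lambda>i. complex_of_real (f (m $ i))) * mat_adjoint V"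
proof -
  define n where "n = dim_row A"
  note [simp] = assoc_mult_mat[of _ n n _ n _ n] mult_carrier_mat[of _ n n _ n]
    right_mult_one_mat[of _ n n]
  define D where "D g l = mat_diag n (\<lambda>i. complex_of_real (g (l $ i)))" for g :: "real \<Rightarrow> real" and l :: "real vec"
  have [simp]: "D g l \<in> carrier_mat n n" for g l by (simp add: D_def)
  from U have Uc[simp]: "U \<in> carrier_mat n n" and "unitary_mat U" and A_U: "A = U * D id l * mat_adjoint U"
    by (auto simp: spectral_decomp_def n_def D_def)
  note UU = unitary_matD[OF this(2,1)]
  from V have Vc[simp]: "V \<in> carrier_mat n n" and "unitary_mat V" and A_V: "A = V * D id m * mat_adjoint V"
    by (auto simp: spectral_decomp_def n_def D_def)
  note VV = unitary_matD[OF this(2,1)]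
  have [simp]: "mat_adjoint U * (U * X) = X" "U * (mat_adjoint U * X) = X"
    "mat_adjoint V * (V * X) = X" "V * (mat_adjoint V * X) = X" if "X \<in> carrier_mat n n" for X
    using that UU VV by (simp_all flip: assoc_mult_mat[of _ n n _ n _ n])
  define W where "W = mat_adjoint V * U"
  have [simp]: "W \<in> carrier_mat n n" by (simp add: W_def)
  have "D id m * W = mat_adjoint V * A * U"
    by (simp add: A_V W_def)
  also have "\<dots> = W * D id l"
    by (simp add: A_U W_def UU)
  finally have eq: "D id m * W = W * D id l" .
  \<comment> \<open>An entry \<open>W $$ (i, j)\<close> can only be nonzero if \<open>m $ i = l $ j\<close>.\<close>
  have "D f m * W = W * D f l"
  proof (rule eq_matI)
    have c: "D f m * W \<in> carrier_mat n n" "W * D f l \<in> carrier_mat n n" by simp_all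
    show "dim_row (D f m * W) = dim_row (W * D f l)" "dim_col (D f m * W) = dim_col (W * D f l)"
      using carrier_matD[OF c(1)] carrier_matD[OF c(2)] by (simp_all only:)
    fix i j assume "i < dim_row (W * D f l)" "j < dim_col (W * D f l)"
    hence ij: "i < n" "j < n" using carrier_matD[OF c(2)] by (simp_all only:)
    have "(D id m * W) $$ (i, j) = (W * D id l) $$ (i, j)" by (simp add: eq)
    hence "complex_of_real (m $ i) * W $$ (i, j) = complex_of_real (l $ j) * W $$ (i, j)"
      using ij unfolding D_def
      by (simp add: mat_diag_mult_left[of _ n n] mat_diag_mult_right[of _ n n] mult.commute del: index_mult_mat)
    hence "W $$ (i, j) = 0 \<or> m $ i = l $ j" by auto
    thus "(D f m * W) $$ (i, j) = (W * D f l) $$ (i, j)"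
      using ij unfolding D_def
      by (auto simp: mat_diag_mult_left[of _ n n] mat_diag_mult_right[of _ n n] mult.commute simp del: index_mult_mat)
  qed
  \<comment> \<open>Since \<open>V * W = U\<close>, this turns the intertwining relation into the
    claim.\<close>
  hence "V * (D f m * W) * mat_adjoint U = V * (W * D f l) * mat_adjoint U" by simp
  hence "V * D f m * mat_adjoint V = U * D f l * mat_adjoint U"
    by (simp add: W_def UU)
  thus ?thesis by (simp add: D_def n_def)
qed

text \<open>This removes the choice from \<open>herm_fun\<close>: any decomposition at hand may be
  used, in particular the output of an eigensolver.\<close>

lemma herm_fun_eq:
  assumes "spectral_decomp A U l"
  shows "herm_fun f A = U * mat_diag (dim_row A) (\<lambda>i. complex_of_real (f (l $ i))) * mat_adjoint U"
proof -
  obtain V m where Vm: "(SOME (U, l). spectral_decomp A U l) = (V, m)" by force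
  have "case (SOME (U, l). spectral_decomp A U l) of (U, l) \<Rightarrow> spectral_decomp A U l"
    by (rule someI[of "\<lambda>(U, l). spectral_decomp A U l" "(U, l)"]) (use assms in simp)
  hence "spectral_decomp A V m" by (simp add: Vm)
  thus ?thesis unfolding herm_fun_def Vm by (simp add: spectral_decomp_unique[OF assms, of V m])
qed

section \<open>Inverse square roots\<close>

lemma spectral_decompD:
  assumes "spectral_decomp A U l" "A \<in> carrier_mat n n"
  shows "U \<in> carrier_mat n n" "unitary_mat U" "l \<in> carrier_vec n"
    "A = U * mat_diag n (\<lambda>i. complex_of_real (l $ i)) * mat_adjoint U"
  using assms by (auto simp: spectral_decomp_def)

lemma unitary_diag_index:
  assumes "U \<in> carrier_mat n n" "i < n" "j < n"
  shows "(U * mat_diag n d * mat_adjoint U) $$ (i, j) = (\<Sum>k<n. U $$ (i, k) * d k * cnj (U $$ (j, k)))"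
  using assms
  by (subst mat_mult_index[of _ n n _ n])
    (auto simp: mat_diag_mult_right[of _ n n] simp del: index_mult_mat intro!: sum.cong)

text \<open>Column i of U is a unit eigenvector, and the quadratic form of A takes the value
  \<open>l $ i\<close> there.\<close>

lemma pos_def_eigenvalue_pos:
  assumes A: "pos_def_mat A" "A \<in> carrier_mat n n" and U: "spectral_decomp A U l" and i: "i < n"
  shows "0 < l $ i"
proof -
  note U = spectral_decompD[OF U A(2)]
  define D where "D = mat_diag n (\<lambda>i. complex_of_real (l $ i))"
  have D: "D \<in> carrier_mat n n" by (simp add: D_def)
  define v where "v = col U i"
  have v: "v \<in> carrier_vec n" using U by (intro carrier_vecI) (simp add: v_def)
  have "A * U = U * D * (mat_adjoint U * U)"
    using U D by (simp add: D_def assoc_mult_mat[of _ n n _ n _ n] mult_carrier_mat[of _ n n _ n])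
  hence "A * U = U * D" using unitary_matD[OF U(2,1)] U D right_mult_one_mat[OF mult_carrier_mat[OF U(1) D]] by simp
  moreover have "col (A * U) i = A *\<^sub>v v"
    unfolding v_def using A U i by (intro col_mult2[of _ n n _ n]) auto
  moreover have "col (U * D) i = complex_of_real (l $ i) \<cdot>\<^sub>v v"
    unfolding D_def v_def mat_diag_mult_right[OF U(1)] using U i by (intro eq_vecI) auto
  ultimately have Av: "A *\<^sub>v v = complex_of_real (l $ i) \<cdot>\<^sub>v v" by simp
  have "v \<bullet>c v = (mat_adjoint U * U) $$ (i, i)"
    using U i by (subst mat_mult_index[of _ n n _ n])
      (auto simp: v_def scalar_prod_def lessThan_atLeast0 mult.commute)
  hence vv: "v \<bullet>c v = 1" using unitary_matD[OF U(2,1)] i by simp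
  hence "v \<noteq> 0\<^sub>v n" by auto
  hence "0 < (A *\<^sub>v v) \<bullet>c v" using A v by (auto simp: pos_def_mat_def)
  thus ?thesis using v vv by (simp add: Av less_complex_def)
qed

lemma hermitian_mat_diag: "hermitian_mat (mat_diag n (\<lambda>i. complex_of_real (d i)))"
  by (rule hermitian_matI[of _ n]) (auto simp: mat_diag_def)

lemma pos_def_hermitian: "pos_def_mat A \<Longrightarrow> hermitian_mat A"
  by (simp add: pos_def_mat_def)

lemma inv_sqrt_mat:
  assumes A: "pos_def_mat A" "A \<in> carrier_mat n n"
  shows "inv_sqrt_mat A \<in> carrier_mat n n" "hermitian_mat (inv_sqrt_mat A)"
    "inv_sqrt_mat A * A * inv_sqrt_mat A = 1\<^sub>m n"
proof -
  note [simp] = assoc_mult_mat[of _ n n _ n _ n] mult_carrier_mat[of _ n n _ n]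
  obtain U l where Ul: "spectral_decomp A U l"
    using spectral_theorem pos_def_hermitian A by blast
  note U[simp] = spectral_decompD(1,2)[OF Ul A(2)] note A_eq = spectral_decompD(4)[OF Ul A(2)]
  note UU = unitary_matD[OF U(2,1)]
  have G: "inv_sqrt_mat A = U * mat_diag n (\<lambda>i. complex_of_real (1 / sqrt (l $ i))) * mat_adjoint U"
    using A herm_fun_eq[OF Ul] by (simp add: inv_sqrt_mat_def)
  show "inv_sqrt_mat A \<in> carrier_mat n n" by (simp add: G)
  show "hermitian_mat (inv_sqrt_mat A)" unfolding G
    by (rule hermitian_congruence[OF hermitian_mat_diag mat_diag_dim U(1)])
  have [simp]: "mat_adjoint U * (U * X) = X" if "X \<in> carrier_mat n n" for X
    using that UU by (simp flip: assoc_mult_mat[of _ n n _ n _ n])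
  define D where "D = mat_diag n (\<lambda>i. complex_of_real (l $ i))"
  define S where "S = mat_diag n (\<lambda>i. complex_of_real (1 / sqrt (l $ i)))"
  have [simp]: "D \<in> carrier_mat n n" "S \<in> carrier_mat n n" by (simp_all add: D_def S_def)
  have "S * (D * S) = mat_diag n (\<lambda>i. complex_of_real (1 / sqrt (l $ i) * (l $ i * (1 / sqrt (l $ i)))))"
    by (simp only: D_def S_def mat_diag_diag of_real_mult)
  also have "\<dots> = 1\<^sub>m n"
  proof -
    \<comment> \<open>Strict positivity is essential: the product would be 0 at a zero eigenvalue
      and -1 at a negative one.\<close>
    have "complex_of_real (1 / sqrt (l $ i) * (l $ i * (1 / sqrt (l $ i)))) = 1" if "i < n" for i
      using pos_def_eigenvalue_pos[OF A Ul that] by simp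
    thus ?thesis unfolding mat_diag_def by (intro eq_matI) (simp_all only: index_mat index_one_mat prod.case dim_row_mat dim_col_mat)
  qed
  finally have SDS: "S * (D * S) = 1\<^sub>m n" .
  have "S * (D * (S * X)) = X" if X: "X \<in> carrier_mat n n" for X
  proof -
    have "S * (D * (S * X)) = (S * (D * S)) * X" using X by simp
    thus ?thesis using left_mult_one_mat[OF X] by (simp only: SDS)
  qed
  hence "(U * S * mat_adjoint U) * (U * D * mat_adjoint U) * (U * S * mat_adjoint U) = 1\<^sub>m n"
    by (simp add: UU)
  thus "inv_sqrt_mat A * A * inv_sqrt_mat A = 1\<^sub>m n"
    unfolding G[folded S_def, symmetric] A_eq[folded D_def, symmetric] .
qed

section \<open>The inverse square root of a scaled transpose\<close>

text \<open>Transposition turns \<open>U D U\<^sup>\<dagger>\<close> into the same expression with U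
  replaced by its entrywise conjugate, which is \<open>transpose_mat (mat_adjoint U)\<close>; the
  diagonal is unchanged.\<close>

lemma spectral_decomp_transpose_scale:
  assumes Ul: "spectral_decomp A U l" and A: "A \<in> carrier_mat n n"
  shows "spectral_decomp (complex_of_real c \<cdot>\<^sub>m transpose_mat A) (transpose_mat (mat_adjoint U)) (c \<cdot>\<^sub>v l)"
proof -
  note U = spectral_decompD[OF Ul A]
  note UU = unitary_matD[OF U(2,1)]
  let ?D = "\<lambda>l :: real vec. mat_diag n (\<lambda>i. complex_of_real (l $ i))"
  have adj: "mat_adjoint (transpose_mat (mat_adjoint U)) = transpose_mat U"
    using U by (intro eq_matI) auto
  have "transpose_mat U * transpose_mat (mat_adjoint U) = transpose_mat (mat_adjoint U * U)"
    using U by (subst transpose_mult[of _ n n _ n]) auto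
  hence "unitary_mat (transpose_mat (mat_adjoint U))"
    using U by (intro unitary_matI[of _ n]) (auto simp: adj UU)
  moreover have "complex_of_real c \<cdot>\<^sub>m transpose_mat A =
      transpose_mat (mat_adjoint U) * ?D (c \<cdot>\<^sub>v l) * mat_adjoint (transpose_mat (mat_adjoint U))"
    (is "_ = ?R")
  proof (rule eq_matI)
    fix i j assume "i < dim_row ?R" "j < dim_col ?R"
    hence ij: "i < n" "j < n" using U by auto
    have "A $$ (j, i) = (\<Sum>k<n. U $$ (j, k) * complex_of_real (l $ k) * cnj (U $$ (i, k)))"
      unfolding arg_cong[OF U(4), of "\<lambda>A. A $$ (j, i)"] using U(1) ij by (subst unitary_diag_index) auto
    moreover have "?R $$ (i, j) =
        (\<Sum>k<n. cnj (U $$ (i, k)) * complex_of_real ((c \<cdot>\<^sub>v l) $ k) * U $$ (j, k))"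
      using U(1) ij by (subst unitary_diag_index) auto
    ultimately show "(complex_of_real c \<cdot>\<^sub>m transpose_mat A) $$ (i, j) = ?R $$ (i, j)"
      using ij U(3) A by (auto simp: sum_distrib_left mult_ac)
  qed (use A U in auto)
  ultimately show ?thesis
    using U A by (simp add: spectral_decomp_def)
qed

text \<open>Needed with \<open>c = 1 / d\<close>, because the reduced state is the transpose of R
  divided by d.\<close>

lemma inv_sqrt_mat_transpose_scale:
  assumes A: "hermitian_mat A" "A \<in> carrier_mat n n" and c: "0 < c"
  shows "inv_sqrt_mat (complex_of_real c \<cdot>\<^sub>m transpose_mat A) =
    complex_of_real (1 / sqrt c) \<cdot>\<^sub>m transpose_mat (inv_sqrt_mat A)" (is "?L = ?R")
proof (rule eq_matI)
  obtain U l where Ul: "spectral_decomp A U l" using spectral_theorem A by blast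
  note U = spectral_decompD[OF Ul A(2)]
  define f where "f x = 1 / sqrt x" for x :: real
  note h = herm_fun_eq[OF Ul] herm_fun_eq[OF spectral_decomp_transpose_scale[OF Ul A(2)]]
  have dims: "inv_sqrt_mat A \<in> carrier_mat n n" "?L \<in> carrier_mat n n"
    using A(2) U(1) by (auto simp: inv_sqrt_mat_def h)
  thus "dim_row ?L = dim_row ?R" "dim_col ?L = dim_col ?R" by auto
  fix i j assume "i < dim_row ?R" "j < dim_col ?R"
  hence ij: "i < n" "j < n" using dims by auto
  have "?L = transpose_mat (mat_adjoint U) * mat_diag n (\<lambda>i. complex_of_real (f ((c \<cdot>\<^sub>v l) $ i))) *
      mat_adjoint (transpose_mat (mat_adjoint U))"
    using A by (simp add: inv_sqrt_mat_def h f_def)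
  hence "?L $$ (i, j) = (\<Sum>k<n. cnj (U $$ (i, k)) * complex_of_real (f ((c \<cdot>\<^sub>v l) $ k)) * U $$ (j, k))"
    using U(1) ij by (simp only:) (subst unitary_diag_index, auto)
  moreover have "inv_sqrt_mat A = U * mat_diag n (\<lambda>i. complex_of_real (f (l $ i))) * mat_adjoint U"
    using A by (simp add: inv_sqrt_mat_def h f_def)
  hence "inv_sqrt_mat A $$ (j, i) = (\<Sum>k<n. U $$ (j, k) * complex_of_real (f (l $ k)) * cnj (U $$ (i, k)))"
    using U(1) ij by (simp only:) (subst unitary_diag_index, auto)
  ultimately show "?L $$ (i, j) = ?R $$ (i, j)"
    using ij U(3) dims
    by (auto simp: sum_distrib_left mult_ac f_def real_sqrt_mult)
qed

section \<open>Kraus maps\<close>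

lemma sum_mats_index [simp]: "i < m \<Longrightarrow> j < n \<Longrightarrow> sum_mats m n r F $$ (i, j) = (\<Sum>k<r. F k $$ (i, j))"
  by (simp add: sum_mats_def)

lemma sum_mats_carrier [simp]: "sum_mats m n r F \<in> carrier_mat m n"
  by (simp add: sum_mats_def)

lemma sum_mats_dim [simp]: "dim_row (sum_mats m n r F) = m" "dim_col (sum_mats m n r F) = n"
  by (simp_all add: sum_mats_def)

lemma sum_mats_mult_mult:
  assumes F: "\<And>k. k < r \<Longrightarrow> F k \<in> carrier_mat n p" and A: "A \<in> carrier_mat m n" and B: "B \<in> carrier_mat p q"
  shows "sum_mats m q r (\<lambda>k. A * F k * B) = A * sum_mats n p r F * B" (is "?L = ?R")
proof (rule eq_matI)
  fix i j assume "i < dim_row ?R" "j < dim_col ?R"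
  hence ij: "i < m" "j < q" using A B by auto
  have "?L $$ (i, j) = (\<Sum>k<r. \<Sum>s<n. \<Sum>t<p. A $$ (i, s) * F k $$ (s, t) * B $$ (t, j))"
    using F A B ij by (auto intro!: sum.cong mat_mult_index3 simp del: index_mult_mat)
  also have "\<dots> = (\<Sum>s<n. \<Sum>k<r. \<Sum>t<p. A $$ (i, s) * F k $$ (s, t) * B $$ (t, j))"
    by (rule sum.swap)
  also have "\<dots> = (\<Sum>s<n. \<Sum>t<p. \<Sum>k<r. A $$ (i, s) * F k $$ (s, t) * B $$ (t, j))"
    by (rule sum.cong[OF refl], rule sum.swap)
  also have "\<dots> = ?R $$ (i, j)"
    using A B ij by (subst mat_mult_index3[of _ m n _ p _ q]) (auto simp: sum_distrib_left sum_distrib_right)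
  finally show "?L $$ (i, j) = ?R $$ (i, j)" .
qed (use A B in auto)

section \<open>Positive semidefinite matrices\<close>

text \<open>Moving L across the scalar product turns the form of
  \<open>L * X * mat_adjoint L\<close> at v into the form of X at
  \<open>mat_adjoint L *\<^sub>v v\<close>.\<close>

lemma psd_mat_congruence:
  assumes X: "psd_mat X" "X \<in> carrier_mat n n" and L: "L \<in> carrier_mat m n"
  shows "psd_mat (L * X * mat_adjoint L)"
proof -
  have "0 \<le> (L * X * mat_adjoint L *\<^sub>v v) \<bullet>c v" if v: "v \<in> carrier_vec m" for v
  proof -
    have "(L * X * mat_adjoint L *\<^sub>v v) \<bullet>c v = (X *\<^sub>v (mat_adjoint L *\<^sub>v v)) \<bullet>c (mat_adjoint L *\<^sub>v v)"
    proof -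
      define w where "w = X *\<^sub>v (mat_adjoint L *\<^sub>v v)"
      have w: "w \<in> carrier_vec n" unfolding w_def
        using X L v by (intro mult_mat_vec_carrier[of _ _ n] mult_mat_vec_carrier[of _ _ m]) auto
      have "L * X * mat_adjoint L *\<^sub>v v = L *\<^sub>v w"
        using X L v by (simp add: w_def assoc_mult_mat_vec[of _ m n _ m] assoc_mult_mat_vec[of _ n n _ m]
            assoc_mult_mat[of _ m n _ n _ m])
      hence "(L * X * mat_adjoint L *\<^sub>v v) \<bullet>c v = (\<Sum>i<m. \<Sum>k<n. L $$ (i, k) * w $ k * cnj (v $ i))"
        using L w v by (auto simp: scalar_prod_def lessThan_atLeast0 sum_distrib_right intro!: sum.cong)
      also have "\<dots> = (\<Sum>k<n. \<Sum>i<m. L $$ (i, k) * w $ k * cnj (v $ i))" by (rule sum.swap)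
      also have "\<dots> = w \<bullet>c (mat_adjoint L *\<^sub>v v)"
        using L w v by (auto simp: scalar_prod_def lessThan_atLeast0 sum_distrib_left mult_ac intro!: sum.cong)
      finally show ?thesis by (simp add: w_def)
    qed
    moreover have "mat_adjoint L *\<^sub>v v \<in> carrier_vec n"
      using L v by (intro mult_mat_vec_carrier[of _ _ m]) auto
    ultimately show ?thesis using X by (auto simp: psd_mat_def)
  qed
  thus ?thesis
    using hermitian_congruence[OF _ X(2) L] X L by (auto simp: psd_mat_def)
qed

lemma psd_mat_sum_mats:
  assumes F: "\<And>k. k < r \<Longrightarrow> F k \<in> carrier_mat n n" "\<And>k. k < r \<Longrightarrow> psd_mat (F k)"
  shows "psd_mat (sum_mats n n r F)"
proof -
  have "hermitian_mat (sum_mats n n r F)"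
    using F by (intro hermitian_matI[of _ n]) (auto simp: psd_mat_def intro!: sum.cong hermitian_matD[of _ n])
  moreover have "0 \<le> (sum_mats n n r F *\<^sub>v v) \<bullet>c v" if v: "v \<in> carrier_vec n" for v
  proof -
    have "(sum_mats n n r F *\<^sub>v v) \<bullet>c v = (\<Sum>i<n. \<Sum>j<n. \<Sum>k<r. F k $$ (i, j) * v $ j * cnj (v $ i))"
      using v by (auto simp: scalar_prod_def lessThan_atLeast0 sum_distrib_right intro!: sum.cong)
    also have "\<dots> = (\<Sum>i<n. \<Sum>k<r. \<Sum>j<n. F k $$ (i, j) * v $ j * cnj (v $ i))"
      by (intro sum.cong refl sum.swap)
    also have "\<dots> = (\<Sum>k<r. \<Sum>i<n. \<Sum>j<n. F k $$ (i, j) * v $ j * cnj (v $ i))"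
      by (rule sum.swap)
    also have "\<dots> = (\<Sum>k<r. (F k *\<^sub>v v) \<bullet>c v)"
    proof (rule sum.cong[OF refl])
      fix k assume "k \<in> {..<r}"
      hence "F k \<in> carrier_mat n n" using F by auto
      thus "(\<Sum>i<n. \<Sum>j<n. F k $$ (i, j) * v $ j * cnj (v $ i)) = (F k *\<^sub>v v) \<bullet>c v"
        using v by (auto simp: scalar_prod_def lessThan_atLeast0 sum_distrib_right intro!: sum.cong)
    qed
    also have "\<dots> \<ge> 0"
    proof (rule sum_nonneg)
      fix k assume "k \<in> {..<r}"
      thus "0 \<le> (F k *\<^sub>v v) \<bullet>c v" using F[of k] v by (auto simp: psd_mat_def)
    qed
    finally show ?thesis .
  qed
  ultimately show ?thesis by (simp add: psd_mat_def)
qed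

lemma kraus_map_carrier [simp]: "kraus_map n r K X \<in> carrier_mat n n"
  by (simp add: kraus_map_def)

lemma kraus_map_dim [simp]: "dim_row (kraus_map n r K X) = n" "dim_col (kraus_map n r K X) = n"
  by (simp_all add: kraus_map_def)

lemma kraus_map_index:
  assumes "\<And>i. i < r \<Longrightarrow> K i \<in> carrier_mat n m" "X \<in> carrier_mat m m" "p < n" "q < n"
  shows "kraus_map n r K X $$ (p, q) =
    (\<Sum>i<r. \<Sum>s<m. \<Sum>t<m. K i $$ (p, s) * X $$ (s, t) * cnj (K i $$ (q, t)))"
  unfolding kraus_map_def using assms(3,4)
proof (simp, intro sum.cong refl)
  fix i assume "i \<in> {..<r}"
  hence K: "K i \<in> carrier_mat n m" using assms by auto
  show "(K i * X * mat_adjoint (K i)) $$ (p, q) =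
      (\<Sum>s<m. \<Sum>t<m. K i $$ (p, s) * X $$ (s, t) * cnj (K i $$ (q, t)))"
    using K assms by (subst mat_mult_index3[of _ n m _ m _ n]) auto
qed

section \<open>Index arithmetic of tensor products\<close>

lemma div_mod_less:
  fixes p k n :: nat
  assumes "p < k * n"
  shows "p div n < k" "p mod n < n"
proof -
  have "0 < n" using assms by (cases n) auto
  with assms show "p div n < k" "p mod n < n" by (auto simp: less_mult_imp_div_less)
qed

lemma index_less: "(a::nat) < k \<Longrightarrow> s < n \<Longrightarrow> a * n + s < k * n"
  by (metis add_strict_left_mono less_le_trans mult_Suc mult_le_mono1 Suc_leI add.commute)

text \<open>As a rewrite rule it pulls a test out of the inner sums whose index it does not mention,
  so that a sum over a tested index collapses to one term.\<close>

lemma sum_if_const: "(\<Sum>x\<in>A. if P then f x else 0) = (if P then \<Sum>x\<in>A. f x else 0)"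
  by simp

lemma sum_div_mod: "(\<Sum>x<k * n. f x) = (\<Sum>a<k. \<Sum>s<n. f (a * n + s :: nat) :: 'a :: comm_monoid_add)"
proof -
  have "(\<Sum>x<k * n. f x) = (\<Sum>a<k. sum f {a * n..<a * n + n})"
    by (rule sum.nat_group[symmetric])
  also have "\<dots> = (\<Sum>a<k. \<Sum>s<n. f (a * n + s))"
  proof (rule sum.cong[OF refl])
    fix a
    show "sum f {a * n..<a * n + n} = (\<Sum>s<n. f (a * n + s))"
      by (rule sum.reindex_bij_witness[of _ "\<lambda>s. a * n + s" "\<lambda>x. x - a * n"]) auto
  qed
  finally show ?thesis .
qed

lemma kron_id_index:
  assumes "A \<in> carrier_mat n m" "p < k * n" "a < k" "s < m"
  shows "(1\<^sub>m k \<otimes>\<^sub>m A) $$ (p, a * m + s) = (if a = p div n then A $$ (p mod n, s) else 0)"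
  using assms div_mod_less[OF assms(2)] index_less[OF assms(3,4)] by (auto simp: kron_def)

section \<open>Complete positivity of Kraus maps\<close>

text \<open>The extended map again has Kraus form, so its positivity reduces to that of congruences
  and their sums.\<close>

lemma id_tensor_kraus_map:
  assumes K: "\<And>i. i < r \<Longrightarrow> K i \<in> carrier_mat n m" and X: "X \<in> carrier_mat (k * m) (k * m)"
  shows "id_tensor k m n (kraus_map n r K) X =
    sum_mats (k * n) (k * n) r (\<lambda>i. (1\<^sub>m k \<otimes>\<^sub>m K i) * X * mat_adjoint (1\<^sub>m k \<otimes>\<^sub>m K i))" (is "?L = ?R")
proof (rule eq_matI)
  fix p q assume "p < dim_row ?R" "q < dim_col ?R"
  hence pq: "p < k * n" "q < k * n" by auto
  note d = div_mod_less[OF pq(1)] div_mod_less[OF pq(2)]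
  have "?L $$ (p, q) = (\<Sum>i<r. \<Sum>s<m. \<Sum>t<m. K i $$ (p mod n, s) *
      X $$ (p div n * m + s, q div n * m + t) * cnj (K i $$ (q mod n, t)))"
    using pq d K by (auto simp: id_tensor_def kraus_map_index[where m = m] intro!: sum.cong)
  also have "\<dots> = ?R $$ (p, q)"
    using pq
  proof (simp, intro sum.cong refl)
    fix i assume "i \<in> {..<r}"
    hence Ki: "K i \<in> carrier_mat n m" using K by auto
    define L where "L = 1\<^sub>m k \<otimes>\<^sub>m K i"
    have L: "L \<in> carrier_mat (k * n) (k * m)" using Ki by (auto simp: L_def kron_def)
    have "(L * X * mat_adjoint L) $$ (p, q) =
        (\<Sum>x<k * m. \<Sum>y<k * m. L $$ (p, x) * X $$ (x, y) * cnj (L $$ (q, y)))"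
      using L X pq by (subst mat_mult_index3[of _ "k * n" "k * m" _ "k * m" _ "k * n"]) auto
    also have "\<dots> = (\<Sum>a<k. \<Sum>s<m. \<Sum>b<k. \<Sum>t<m.
        L $$ (p, a * m + s) * X $$ (a * m + s, b * m + t) * cnj (L $$ (q, b * m + t)))"
      by (simp add: sum_div_mod)
    \<comment> \<open>L is block diagonal with k copies of \<open>K i\<close>; only the blocks of
      the row indices p and q contribute.\<close>
    also have "\<dots> = (\<Sum>a<k. \<Sum>s<m. \<Sum>b<k. \<Sum>t<m. if a = p div n then if b = q div n then
        K i $$ (p mod n, s) * X $$ (a * m + s, b * m + t) * cnj (K i $$ (q mod n, t)) else 0 else 0)"
      by (intro sum.cong refl) (auto simp: L_def kron_id_index[OF Ki] pq)
    also have "\<dots> = (\<Sum>s<m. \<Sum>t<m. K i $$ (p mod n, s) *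
        X $$ (p div n * m + s, q div n * m + t) * cnj (K i $$ (q mod n, t)))"
      using d by (simp add: sum_if_const)
    finally show "(\<Sum>s<m. \<Sum>t<m. K i $$ (p mod n, s) *
        X $$ (p div n * m + s, q div n * m + t) * cnj (K i $$ (q mod n, t))) =
        ((1\<^sub>m k \<otimes>\<^sub>m K i) * X * mat_adjoint (1\<^sub>m k \<otimes>\<^sub>m K i)) $$ (p, q)"
      by (simp add: L_def)
  qed
  finally show "?L $$ (p, q) = ?R $$ (p, q)" .
qed (auto simp: id_tensor_def)

lemma completely_positive_kraus_map:
  assumes K: "\<And>i. i < r \<Longrightarrow> K i \<in> carrier_mat n m"
  shows "completely_positive m n (kraus_map n r K)"
  unfolding completely_positive_def linear_superop_def
proof (intro conjI ballI allI impI)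
  fix X Y :: "complex mat" assume XY: "X \<in> carrier_mat m m" "Y \<in> carrier_mat m m"
  show "kraus_map n r K (X + Y) = kraus_map n r K X + kraus_map n r K Y"
    by (rule eq_matI)
      (use XY K in \<open>auto simp: kraus_map_index[where m = m] algebra_simps sum.distrib\<close>)
next
  fix c and X :: "complex mat" assume X: "X \<in> carrier_mat m m"
  show "kraus_map n r K (c \<cdot>\<^sub>m X) = c \<cdot>\<^sub>m kraus_map n r K X"
    by (rule eq_matI)
      (use X K in \<open>auto simp: kraus_map_index[where m = m] sum_distrib_left mult_ac\<close>)
next
  fix k X assume X: "X \<in> carrier_mat (k * m) (k * m)" "psd_mat X"
  have L: "1\<^sub>m k \<otimes>\<^sub>m K i \<in> carrier_mat (k * n) (k * m)" if "i < r" for i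
    using K[OF that] by (auto simp: kron_def)
  show "psd_mat (id_tensor k m n (kraus_map n r K) X)"
    by (subst id_tensor_kraus_map[OF K X(1)])
      (use L X(1) psd_mat_congruence[OF X(2,1) L] in \<open>auto intro!: psd_mat_sum_mats mult_carrier_mat mat_adjoint_carrier\<close>)
qed simp_all

section \<open>Trace preservation\<close>

lemma kraus_R_carrier [simp]: "kraus_R m r K \<in> carrier_mat m m"
  by (simp add: kraus_R_def)

lemma kraus_R_dim [simp]: "dim_row (kraus_R m r K) = m" "dim_col (kraus_R m r K) = m"
  by (simp_all add: kraus_R_def)

lemma kraus_R_index:
  assumes K: "\<And>i. i < r \<Longrightarrow> K i \<in> carrier_mat n m" and ij: "i < m" "j < m"
  shows "kraus_R m r K $$ (i, j) = (\<Sum>k<r. \<Sum>b<n. cnj (K k $$ (b, i)) * K k $$ (b, j))"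
  unfolding kraus_R_def using ij
proof (simp, intro sum.cong refl)
  fix k assume "k \<in> {..<r}"
  hence "K k \<in> carrier_mat n m" using K by auto
  thus "(mat_adjoint (K k) * K k) $$ (i, j) = (\<Sum>b<n. cnj (K k $$ (b, i)) * K k $$ (b, j))"
    using ij by (subst mat_mult_index[of _ m n _ m]) auto
qed

text \<open>Cyclicity of the trace, written in entries: the swaps bring the quadruple sum from the
  order b, k, s, t to t, s, k, b. Consequently R = I means trace preservation.\<close>

lemma trace_kraus_map:
  assumes K: "\<And>i. i < r \<Longrightarrow> K i \<in> carrier_mat n m" and X: "X \<in> carrier_mat m m"
  shows "trace_mat (kraus_map n r K X) = trace_mat (kraus_R m r K * X)"
proof -
  have "trace_mat (kraus_map n r K X) =
      (\<Sum>b<n. \<Sum>k<r. \<Sum>s<m. \<Sum>t<m. K k $$ (b, s) * X $$ (s, t) * cnj (K k $$ (b, t)))"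
    using K X by (simp add: trace_mat_def kraus_map_index[where m = m] )
  also have "\<dots> = (\<Sum>k<r. \<Sum>b<n. \<Sum>s<m. \<Sum>t<m. K k $$ (b, s) * X $$ (s, t) * cnj (K k $$ (b, t)))"
    by (rule sum.swap)
  also have "\<dots> = (\<Sum>k<r. \<Sum>b<n. \<Sum>t<m. \<Sum>s<m. K k $$ (b, s) * X $$ (s, t) * cnj (K k $$ (b, t)))"
    by (intro sum.cong refl sum.swap)
  also have "\<dots> = (\<Sum>k<r. \<Sum>t<m. \<Sum>b<n. \<Sum>s<m. K k $$ (b, s) * X $$ (s, t) * cnj (K k $$ (b, t)))"
    by (intro sum.cong refl sum.swap)
  also have "\<dots> = (\<Sum>t<m. \<Sum>k<r. \<Sum>b<n. \<Sum>s<m. K k $$ (b, s) * X $$ (s, t) * cnj (K k $$ (b, t)))"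
    by (rule sum.swap)
  also have "\<dots> = (\<Sum>t<m. \<Sum>k<r. \<Sum>s<m. \<Sum>b<n. K k $$ (b, s) * X $$ (s, t) * cnj (K k $$ (b, t)))"
    by (intro sum.cong refl sum.swap)
  also have "\<dots> = (\<Sum>t<m. \<Sum>s<m. \<Sum>k<r. \<Sum>b<n. K k $$ (b, s) * X $$ (s, t) * cnj (K k $$ (b, t)))"
    by (intro sum.cong refl sum.swap)
  also have "\<dots> = (\<Sum>t<m. (kraus_R m r K * X) $$ (t, t))"
    by (intro sum.cong refl, subst mat_mult_index[of _ m m _ m])
      (use K X in \<open>auto simp: kraus_R_index[where n = n] sum_distrib_left sum_distrib_right mult_ac intro!: sum.cong\<close>)
  finally show ?thesis using X by (simp add: trace_mat_def )
qed

lemma normalized_kraus_carrier: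
  assumes "K i \<in> carrier_mat n m" "pos_def_mat (kraus_R m r K)"
  shows "normalized_kraus m r K i \<in> carrier_mat n m"
  using assms inv_sqrt_mat(1)[of "kraus_R m r K" m] by (auto simp: normalized_kraus_def)

lemma kraus_R_normalized_kraus:
  assumes K: "\<And>i. i < r \<Longrightarrow> K i \<in> carrier_mat n m" and R: "pos_def_mat (kraus_R m r K)"
  shows "kraus_R m r (normalized_kraus m r K) = 1\<^sub>m m"
proof -
  define G where "G = inv_sqrt_mat (kraus_R m r K)"
  note G = inv_sqrt_mat[OF R kraus_R_carrier, folded G_def]
  have Gadj: "mat_adjoint G = G" using G by (simp add: hermitian_mat_def)
  have "kraus_R m r (normalized_kraus m r K) = sum_mats m m r (\<lambda>i. G * (mat_adjoint (K i) * K i) * G)"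
    unfolding kraus_R_def
  proof (rule eq_matI; simp; intro sum.cong refl)
    fix a b i assume "i \<in> {..<r}"
    hence Ki: "K i \<in> carrier_mat n m" using K by auto
    have "mat_adjoint (K i * G) * (K i * G) = G * (mat_adjoint (K i) * K i) * G"
      using Ki G Gadj by (simp add: mat_adjoint_mult[OF Ki] assoc_mult_mat[of _ m n _ m _ m]
          assoc_mult_mat[of _ m m _ m _ m] assoc_mult_mat[of _ m m _ n _ m] mult_carrier_mat[of _ m n _ m])
    thus "(mat_adjoint (normalized_kraus m r K i) * normalized_kraus m r K i) $$ (a, b) =
        (G * (mat_adjoint (K i) * K i) * G) $$ (a, b)"
      by (simp add: normalized_kraus_def G_def)
  qed
  also have "\<dots> = G * kraus_R m r K * G"
    unfolding kraus_R_def by (rule sum_mats_mult_mult[OF _ G(1) G(1)])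
      (use K in \<open>auto intro!: mult_carrier_mat[of _ m n _ m]\<close>)
  finally show ?thesis using G by simp
qed

lemma quantum_channel_normalized_kraus:
  assumes K: "\<And>i. i < r \<Longrightarrow> K i \<in> carrier_mat n m" and R: "pos_def_mat (kraus_R m r K)"
  shows "quantum_channel m n (kraus_map n r (normalized_kraus m r K))"
proof -
  have "normalized_kraus m r K i \<in> carrier_mat n m" if "i < r" for i
    using normalized_kraus_carrier K R that by blast
  thus ?thesis
    by (auto simp: quantum_channel_def completely_positive_kraus_map trace_kraus_map[where m = m]
        kraus_R_normalized_kraus[OF K R])
qed

section \<open>The fidelity projection of a Choi matrix\<close>

text \<open>An instance constrains its map only on matrices of the right size, and
  \<open>id_tensor\<close> applies the map to nothing else.\<close>

lemma choi_cong:
  assumes "\<And>X. X \<in> carrier_mat m m \<Longrightarrow> \<Phi> X = \<Psi> X"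
  shows "choi m n \<Phi> = choi m n \<Psi>"
  using assms by (simp add: choi_def id_tensor_def)

lemma choi_dim [simp]: "dim_row (choi m n \<Phi>) = m * n" "dim_col (choi m n \<Phi>) = m * n"
  by (simp_all add: choi_def id_tensor_def)

text \<open>\<open>p div n\<close> is the basis index on A, hence a column of \<open>K i\<close>;
  \<open>p mod n\<close> is the one on B, hence a row.\<close>

lemma choi_kraus_index:
  assumes K: "\<And>i. i < r \<Longrightarrow> K i \<in> carrier_mat n m" and pq: "p < m * n" "q < m * n"
  shows "choi m n (kraus_map n r K) $$ (p, q) =
    (\<Sum>i<r. K i $$ (p mod n, p div n) * cnj (K i $$ (q mod n, q div n))) / of_nat m"
proof -
  note d = div_mod_less[OF pq(1)] div_mod_less[OF pq(2)]
  have sq: "complex_of_real (1 / sqrt (real m)) * complex_of_real (1 / sqrt (real m)) = 1 / of_nat m"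
    by (simp flip: of_real_mult)
  \<comment> \<open>The block (a, b) of the maximally entangled projector is the matrix unit at (a,
    b) divided by m.\<close>
  have max: "ketbra (max_entangled m) $$ (a * m + s, b * m + t) =
      (if s = a then if t = b then 1 / of_nat m else 0 else 0)" if "a < m" "b < m" "s < m" "t < m" for a b s t
    using that index_less[OF that(1,3)] index_less[OF that(2,4)]
    by (auto simp: ketbra_def max_entangled_def sq simp del: of_real_divide)
  have "choi m n (kraus_map n r K) $$ (p, q) = (\<Sum>i<r. \<Sum>s<m. \<Sum>t<m. K i $$ (p mod n, s) *
      (if s = p div n then if t = q div n then 1 / of_nat m else 0 else 0) * cnj (K i $$ (q mod n, t)))"
    using pq d K by (auto simp: choi_def id_tensor_def kraus_map_index[where m = m] max intro!: sum.cong)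
  also have "\<dots> = (\<Sum>i<r. \<Sum>s<m. \<Sum>t<m. if s = p div n then if t = q div n then
      K i $$ (p mod n, s) * cnj (K i $$ (q mod n, t)) / of_nat m else 0 else 0)"
    by (intro sum.cong refl) auto
  also have "\<dots> = (\<Sum>i<r. K i $$ (p mod n, p div n) * cnj (K i $$ (q mod n, q div n))) / of_nat m"
    using d by (simp add: sum_if_const sum_divide_distrib)
  finally show ?thesis .
qed

text \<open>Here the transpose arises: tracing out B leaves the conjugate on the second factor,
  belonging to j, while R carries it on the first.\<close>

lemma partial_trace_choi_kraus:
  assumes K: "\<And>i. i < r \<Longrightarrow> K i \<in> carrier_mat n m"
  shows "partial_trace_B m n (choi m n (kraus_map n r K)) =
    complex_of_real (1 / real m) \<cdot>\<^sub>m transpose_mat (kraus_R m r K)" (is "?L = ?R")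
proof (rule eq_matI)
  fix i j assume "i < dim_row ?R" "j < dim_col ?R"
  hence ij: "i < m" "j < m" by (simp_all add: kraus_R_def)
  have "?L $$ (i, j) = (\<Sum>b<n. \<Sum>k<r. K k $$ (b, i) * cnj (K k $$ (b, j))) / of_nat m"
    using ij by (auto simp: partial_trace_B_def choi_kraus_index[OF K] index_less sum_divide_distrib intro!: sum.cong)
  also have "\<dots> = ?R $$ (i, j)"
    using ij by (subst sum.swap) (simp add: kraus_R_index[OF K]  mult.commute)
  finally show "?L $$ (i, j) = ?R $$ (i, j)" .
qed (simp_all add: partial_trace_B_def kraus_R_def)

lemma kron_id_right_index:
  assumes T: "T \<in> carrier_mat m m" and "p < m * n" "q < m * n"
  shows "(T \<otimes>\<^sub>m 1\<^sub>m n) $$ (p, q) = (if p mod n = q mod n then T $$ (p div n, q div n) else 0)"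
  using assms div_mod_less[of p m n] div_mod_less[of q m n] by (auto simp: kron_def)

lemma fidelity_projection_choi_kraus:
  assumes K: "\<And>i. i < r \<Longrightarrow> K i \<in> carrier_mat n m" and R: "pos_def_mat (kraus_R m r K)" and m: "0 < m"
  shows "fidelity_projection m n (choi m n (kraus_map n r K)) =
    choi m n (kraus_map n r (normalized_kraus m r K))" (is "?L = ?R")
proof -
  define G where "G = inv_sqrt_mat (kraus_R m r K)"
  note G = inv_sqrt_mat[OF R kraus_R_carrier, folded G_def]
  \<comment> \<open>The factor is \<open>1 / sqrt c\<close> for \<open>c = 1 / m\<close>.\<close>
  define T where "T = complex_of_real (sqrt (real m)) \<cdot>\<^sub>m transpose_mat G"
  have T: "T \<in> carrier_mat m m" using G by (simp add: T_def)
  have inv: "inv_sqrt_mat (partial_trace_B m n (choi m n (kraus_map n r K))) = T"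
    using inv_sqrt_mat_transpose_scale[OF pos_def_hermitian[OF R] kraus_R_carrier, of "1 / real m"] m
    by (simp add: partial_trace_choi_kraus[OF K] T_def G_def real_sqrt_divide)
  define S where "S = T \<otimes>\<^sub>m 1\<^sub>m n"
  have S: "S \<in> carrier_mat (m * n) (m * n)" using T by (auto simp: S_def kron_def)
  define \<rho> where "\<rho> = choi m n (kraus_map n r K)"
  have \<rho>: "\<rho> \<in> carrier_mat (m * n) (m * n)" by (simp add: \<rho>_def carrier_matI)
  have L: "?L = (1 / of_nat m) \<cdot>\<^sub>m (S * \<rho> * S)"
    by (simp add: fidelity_projection_def inv Let_def S_def \<rho>_def)
  have N: "normalized_kraus m r K i \<in> carrier_mat n m" if "i < r" for i
    using normalized_kraus_carrier K R that by blast
  have N_index: "normalized_kraus m r K i $$ (b, a) = (\<Sum>c<m. K i $$ (b, c) * G $$ (c, a))"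
    if "i < r" "a < m" "b < n" for i a b
    using K[OF that(1)] G(1) that unfolding normalized_kraus_def G_def[symmetric]
    by (subst mat_mult_index[of _ n m _ m]) auto
  show ?thesis
  proof (rule eq_matI)
    fix p q assume "p < dim_row ?R" "q < dim_col ?R"
    hence pq: "p < m * n" "q < m * n" by simp_all
    note d = div_mod_less[OF pq(1)] div_mod_less[OF pq(2)]
    have "(S * \<rho> * S) $$ (p, q) = (\<Sum>x<m * n. \<Sum>y<m * n. S $$ (p, x) * \<rho> $$ (x, y) * S $$ (y, q))"
      by (rule mat_mult_index3[OF S \<rho> S pq])
    also have "\<dots> = (\<Sum>a<m. \<Sum>s<n. \<Sum>b<m. \<Sum>t<n. S $$ (p, a * n + s) * \<rho> $$ (a * n + s, b * n + t) * S $$ (b * n + t, q))"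
      by (simp add: sum_div_mod)
    also have "\<dots> = (\<Sum>a<m. \<Sum>s<n. \<Sum>b<m. \<Sum>t<n. if s = p mod n then if t = q mod n then
        T $$ (p div n, a) * \<rho> $$ (a * n + s, b * n + t) * T $$ (b, q div n) else 0 else 0)"
      using pq by (intro sum.cong refl) (auto simp: S_def kron_id_right_index[OF T] index_less)
    also have "\<dots> = (\<Sum>a<m. \<Sum>b<m. T $$ (p div n, a) * \<rho> $$ (a * n + p mod n, b * n + q mod n) * T $$ (b, q div n))"
      using d by (simp add: sum_if_const)
    also have "\<dots> = (\<Sum>a<m. \<Sum>b<m. \<Sum>i<r. (K i $$ (p mod n, a) * G $$ (a, p div n)) *
        cnj (K i $$ (q mod n, b) * G $$ (b, q div n)))"
    proof (intro sum.cong refl)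
      fix a b assume "a \<in> {..<m}" "b \<in> {..<m}"
      hence ab: "a < m" "b < m" by auto
      have sq: "complex_of_real (sqrt (real m)) * complex_of_real (sqrt (real m)) = of_nat m"
        by (simp flip: of_real_mult)
      \<comment> \<open>T is a multiple of the transpose of G, so its left occurrence gives the
        entry of G wanted for \<open>K i * G\<close>. At the right occurrence Hermiticity of G
        supplies the conjugate that the second factor needs.\<close>
      have "T $$ (p div n, a) * \<rho> $$ (a * n + p mod n, b * n + q mod n) * T $$ (b, q div n) =
        (complex_of_real (sqrt (real m)) * complex_of_real (sqrt (real m)) / of_nat m) *
        (G $$ (a, p div n) * cnj (G $$ (b, q div n)) * (\<Sum>i<r. K i $$ (p mod n, a) * cnj (K i $$ (q mod n, b))))"
        using ab d G(1) hermitian_matD[OF G(2,1), of b "q div n"]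
        by (simp add: T_def \<rho>_def choi_kraus_index[OF K] index_less mult_ac)
      thus "T $$ (p div n, a) * \<rho> $$ (a * n + p mod n, b * n + q mod n) * T $$ (b, q div n) =
        (\<Sum>i<r. (K i $$ (p mod n, a) * G $$ (a, p div n)) * cnj (K i $$ (q mod n, b) * G $$ (b, q div n)))"
        using m by (simp add: sq sum_distrib_left mult_ac)
    qed
    also have "\<dots> = (\<Sum>a<m. \<Sum>i<r. \<Sum>b<m. (K i $$ (p mod n, a) * G $$ (a, p div n)) *
        cnj (K i $$ (q mod n, b) * G $$ (b, q div n)))"
      by (intro sum.cong refl sum.swap)
    also have "\<dots> = (\<Sum>i<r. \<Sum>a<m. \<Sum>b<m. (K i $$ (p mod n, a) * G $$ (a, p div n)) *
        cnj (K i $$ (q mod n, b) * G $$ (b, q div n)))"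
      by (rule sum.swap)
    also have "\<dots> = of_nat m * ?R $$ (p, q)"
      using m pq d by (simp add: choi_kraus_index[OF N] N_index sum_product)
    finally show "?L $$ (p, q) = ?R $$ (p, q)"
      using pq S m by (simp add: L carrier_matD[OF S] del: index_mult_mat(1))
  qed (use S in \<open>simp_all add: L\<close>)
qed

section \<open>Reasoning about programs\<close>

text \<open>Landau bounds hold only eventually. The finitely many small arguments are absorbed by
  adding the sum of their values to the constant, which suffices since \<open>d ^ k\<close> is at
  least 1 for positive d.\<close>

lemma bigo_power_bound:
  assumes "(\<lambda>d. real (f d)) \<in> O(\<lambda>d. real d ^ k)"
  obtains c :: nat where "\<And>d. 0 < d \<Longrightarrow> f d \<le> c * d ^ k"
proof -
  obtain C where "eventually (\<lambda>d. norm (real (f d)) \<le> C * norm (real d ^ k)) sequentially"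
    using landau_o.bigE[OF assms] by blast
  then obtain N where N: "\<And>d. N \<le> d \<Longrightarrow> real (f d) \<le> C * real d ^ k"
    by (auto simp: eventually_sequentially)
  define c where "c = nat \<lceil>C\<rceil> + (\<Sum>d<N. f d)"
  have "f d \<le> c * d ^ k" if d: "0 < d" for d
  proof (cases "d < N")
    case True
    hence "f d \<le> (\<Sum>d<N. f d)" by (intro member_le_sum) auto
    also have "\<dots> \<le> c * 1" by (simp add: c_def)
    also have "\<dots> \<le> c * d ^ k" using d by (intro mult_le_mono) auto
    finally show ?thesis .
  next
    case False
    hence "real (f d) \<le> C * real d ^ k" using N by simp
    also have "C \<le> real c"
      using real_nat_ceiling_ge[of C] by (simp add: c_def add_increasing2 sum_nonneg)
    hence "C * real d ^ k \<le> real c * real d ^ k" by (intro mult_right_mono) simp_all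
    finally show ?thesis by (simp flip: of_nat_mult of_nat_power)
  qed
  thus ?thesis using that by blast
qed

text \<open>The programs below only use the index variables \<open>0, \<dots>, 6\<close>, so the memory of these is bounded by a constant.\<close>

definition env :: "(nat \<times> nat) list \<Rightarrow> state \<Rightarrow> bool" where
  "env E s \<longleftrightarrow> (\<forall>(x, v) \<in> set E. idx s x = Some v) \<and> dom (idx s) \<subseteq> {..6}"

section \<open>Symbolic evaluation of expressions\<close>

text \<open>Quantifying over all states that agree with E turns evaluation into syntax-directed
  rules, so loop bodies are handled without unfolding states.\<close>

definition has_ival :: "(nat \<times> nat) list \<Rightarrow> iexp \<Rightarrow> nat \<Rightarrow> bool" where
  "has_ival E e n \<longleftrightarrow> (\<forall>s. env E s \<longrightarrow> ieval s e = Some n)"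

definition has_nval ::
  "(nat \<times> nat) list \<Rightarrow> (nat \<times> nat \<Rightarrow> complex mat option) \<Rightarrow> nexp \<Rightarrow> complex \<Rightarrow> bool" where
  "has_nval E m e x \<longleftrightarrow> (\<forall>s. env E s \<and> store s = m \<longrightarrow> neval s e = Some x)"

lemma has_ival_const: "has_ival E (IConst n) n"
  by (simp add: has_ival_def)

lemma has_ival_var: "(x, n) \<in> set E \<Longrightarrow> has_ival E (IVar x) n"
  by (auto simp: has_ival_def env_def)

lemmas has_ival = has_ival_const has_ival_var

lemma has_nval_cell:
  assumes "has_ival E sl k" "m (a, k) = Some A" "has_ival E i p" "has_ival E j q" "p < dim_row A" "q < dim_col A"
  shows "has_nval E m (NCell (a, sl) i j) (A $$ (p, q))"
  using assms by (auto simp: has_nval_def has_ival_def address_def in_bounds_def)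

lemma has_nval_column:
  assumes "has_ival E sl k" "m (a, k) = Some (column_mat l)" "has_ival E i p" "has_ival E j 0" "p < dim_vec l"
  shows "has_nval E m (NCell (a, sl) i j) (complex_of_real (l $ p))"
  using assms by (auto simp: has_nval_def has_ival_def address_def in_bounds_def column_mat_def)

lemma has_nval_mul: "has_nval E m e x \<Longrightarrow> has_nval E m f y \<Longrightarrow> has_nval E m (NMul e f) (x * y)"
  by (auto simp: has_nval_def)

lemma has_nval_conj: "has_nval E m e x \<Longrightarrow> has_nval E m (NConj e) (cnj x)"
  by (auto simp: has_nval_def)

text \<open>Positivity of y excludes both run-time errors, a bad root and a zero divisor.\<close>

lemma has_nval_div_sqrt:
  "has_nval E m e x \<Longrightarrow> has_nval E m f (complex_of_real y) \<Longrightarrow> 0 < y \<Longrightarrow>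
    has_nval E m (NDiv e (NSqrt f)) (x / complex_of_real (sqrt y))"
  by (auto simp: has_nval_def)

text \<open>Every innermost assignment adds to one entry. With effects described as increments, a
  loop has the sum of the increments of its iterations, and no invariant has to be invented for each
  loop.\<close>

definition accum :: "complex mat \<Rightarrow> (nat \<times> nat \<Rightarrow> complex) \<Rightarrow> complex mat" where
  "accum A g = mat (dim_row A) (dim_col A) (\<lambda>ij. A $$ ij + g ij)"

lemma accum_carrier [simp]: "A \<in> carrier_mat p q \<Longrightarrow> accum A g \<in> carrier_mat p q"
  by (auto simp: accum_def)

lemma accum_accum: "accum (accum A g) h = accum A (\<lambda>ij. g ij + h ij)"
  by (rule eq_matI) (auto simp: accum_def)

lemma accum_zero: "accum A (\<lambda>ij. 0) = A"
  by (rule eq_matI) (auto simp: accum_def)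

section \<open>A program logic with time bounds\<close>

locale machine =
  fixes eig :: "complex mat \<Rightarrow> complex mat \<times> real vec" and T M :: "nat \<Rightarrow> nat" and q :: nat
begin

text \<open>A total-correctness triple. Time adds up along a run and is bounded by t; scratch space
  is a maximum, so one bound q for all commands is enough.\<close>

definition runs ::
  "(nat \<times> nat) list \<Rightarrow> (nat \<times> nat \<Rightarrow> complex mat option) \<Rightarrow> com \<Rightarrow>
   (nat \<times> nat \<Rightarrow> complex mat option) \<Rightarrow> nat \<Rightarrow> bool" where
  "runs E m c m' t \<longleftrightarrow> (\<forall>s. env E s \<and> store s = m \<and> scratch s \<le> q \<longrightarrow>
     (\<exists>s'. exec eig T M c s = Some s' \<and> env E s' \<and> store s' = m' \<and> scratch s' \<le> q \<and> ops s' \<le> ops s + t))"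

lemma runsE:
  assumes "runs E m c m' t" "env E s" "store s = m" "scratch s \<le> q"
  obtains s' where "exec eig T M c s = Some s'" "env E s'" "store s' = m'" "scratch s' \<le> q" "ops s' \<le> ops s + t"
  using assms unfolding runs_def by blast

lemma runs_Seq:
  assumes "runs E m c m1 t" "runs E m1 d m2 u"
  shows "runs E m (Seq c d) m2 (t + u)"
  unfolding runs_def
proof (intro allI impI, elim conjE)
  fix s assume s: "env E s" "store s = m" "scratch s \<le> q"
  from runsE[OF assms(1) s] obtain s1 where
    1: "exec eig T M c s = Some s1" "env E s1" "store s1 = m1" "scratch s1 \<le> q" "ops s1 \<le> ops s + t" .
  from runsE[OF assms(2) 1(2-4)] obtain s2 where
    "exec eig T M d s1 = Some s2" "env E s2" "store s2 = m2" "scratch s2 \<le> q" "ops s2 \<le> ops s1 + u" .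
  thus "\<exists>s'. exec eig T M (Seq c d) s = Some s' \<and> env E s' \<and> store s' = m2 \<and> scratch s' \<le> q \<and>
      ops s' \<le> ops s + (t + u)"
    using 1 by (intro exI[of _ s2]) auto
qed

lemma runs_New:
  assumes "has_ival E sl k" "m (a, k) = None" "has_ival E i p" "has_ival E j r"
  shows "runs E m (New (a, sl) i j) (m((a, k) \<mapsto> 0\<^sub>m p r)) (p * r + 1)"
  using assms by (auto simp: runs_def has_ival_def address_def charge_def env_def)

lemma runs_Eig:
  assumes "m (a, k) = Some A" "hermitian_mat A" "m (b, k) = None" "m (c, k) = None" "b \<noteq> c"
    and "eig A = (U, l)" "M (dim_row A) \<le> q"
  shows "runs E m (Eig (a, IConst k) (b, IConst k) (c, IConst k))
    (m((b, k) \<mapsto> U, (c, k) \<mapsto> column_mat l)) (T (dim_row A))"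
  using assms by (auto simp: runs_def address_def charge_def env_def)

text \<open>The true bound is \<open>1 + n * (t + 1)\<close>. It is at most \<open>3 * n * t\<close>
  for positive n and t, and this form makes the costs of nested loops multiply.\<close>

lemma runs_For:
  assumes x: "x \<le> 6" "x \<notin> fst ` set E" and b: "has_ival E b n"
    and pos: "0 < n" "0 < t"
    and body: "\<And>i. i < n \<Longrightarrow> runs ((x, i) # E) (f i) c (f (Suc i)) t"
  shows "runs E (f 0) (For x b c) (f n) (3 * n * t)"
  unfolding runs_def
proof (intro allI impI, elim conjE)
  fix s assume s: "env E s" "store s = f 0" "scratch s \<le> q"
  define step where
    "step = (\<lambda>t i. do { s' \<leftarrow> t; exec eig T M c (charge 1 0 (s'\<lparr>idx := (idx s')(x \<mapsto> i)\<rparr>)) })"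
  have "\<exists>s'. foldl step (Some (charge 1 0 s)) [0..<k] = Some s' \<and> env E s' \<and> store s' = f k \<and>
      scratch s' \<le> q \<and> ops s' \<le> ops s + 1 + k * (t + 1)" if "k \<le> n" for k
    using that
  proof (induction k)
    case 0
    show ?case using s by (auto simp: charge_def env_def)
  next
    case (Suc k)
    then obtain s' where s': "foldl step (Some (charge 1 0 s)) [0..<k] = Some s'" "env E s'" "store s' = f k"
      "scratch s' \<le> q" "ops s' \<le> ops s + 1 + k * (t + 1)" by auto
    let ?s = "charge 1 0 (s'\<lparr>idx := (idx s')(x \<mapsto> k)\<rparr>)"
    have "env ((x, k) # E) ?s" using s'(2) x by (force simp: env_def charge_def)
    moreover have "store ?s = f k" "scratch ?s \<le> q" using s' by (auto simp: charge_def)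
    moreover have "k < n" using Suc.prems by simp
    ultimately obtain s'' where s'': "exec eig T M c ?s = Some s''" "env ((x, k) # E) s''" "store s'' = f (Suc k)"
      "scratch s'' \<le> q" "ops s'' \<le> ops ?s + t"
      using runsE[OF body] by metis
    hence "foldl step (Some (charge 1 0 s)) [0..<Suc k] = Some s''" using s'(1) by (simp add: step_def)
    moreover have "ops s'' \<le> ops s + 1 + Suc k * (t + 1)" using s''(5) s'(5) by (simp add: charge_def)
    \<comment> \<open>The counter keeps its last value after an iteration; its binding is simply
      forgotten.\<close>
    moreover have "env E s''" using s''(2) by (simp add: env_def)
    ultimately show ?case using s''(3,4) by blast
  qed
  from this[of n] obtain s' where s': "foldl step (Some (charge 1 0 s)) [0..<n] = Some s'" "env E s'"
    "store s' = f n" "scratch s' \<le> q" "ops s' \<le> ops s + 1 + n * (t + 1)" by auto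
  have "n \<le> n * t" "0 < n * t" using pos by simp_all
  moreover have "n * (t + 1) = n * t + n" "3 * n * t = n * t + n * t + n * t" by simp_all
  ultimately have "ops s' \<le> ops s + 3 * n * t" using s'(5) by linarith
  moreover have "exec eig T M (For x b c) s = Some s'"
    using s' s(1) b by (simp add: step_def has_ival_def)
  ultimately show "\<exists>s'. exec eig T M (For x b c) s = Some s' \<and> env E s' \<and> store s' = f n \<and> scratch s' \<le> q \<and>
      ops s' \<le> ops s + 3 * n * t"
    using s' by blast
qed

text \<open>The body is required for every A, because iteration i starts from what the earlier ones
  have accumulated.\<close>

lemma runs_accum_For:
  assumes "x \<le> 6" "x \<notin> fst ` set E" "has_ival E b n" "0 < n" "0 < t" and A: "A \<in> carrier_mat p r"
    and body: "\<And>i A. i < n \<Longrightarrow> A \<in> carrier_mat p r \<Longrightarrow>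
      runs ((x, i) # E) (m(k \<mapsto> A)) c (m(k \<mapsto> accum A (g i))) t"
  shows "runs E (m(k \<mapsto> A)) (For x b c) (m(k \<mapsto> accum A (\<lambda>ij. \<Sum>i<n. g i ij))) (3 * n * t)"
proof -
  define f where "f i = m(k \<mapsto> accum A (\<lambda>ij. \<Sum>i'<i. g i' ij))" for i
  have "runs E (f 0) (For x b c) (f n) (3 * n * t)"
  proof (rule runs_For[OF assms(1-5)])
    fix i assume "i < n"
    hence "runs ((x, i) # E) (m(k \<mapsto> accum A (\<lambda>ij. \<Sum>i'<i. g i' ij))) c
        (m(k \<mapsto> accum (accum A (\<lambda>ij. \<Sum>i'<i. g i' ij)) (g i))) t"
      using A by (intro body) auto
    thus "runs ((x, i) # E) (f i) c (f (Suc i)) t"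
      by (simp add: f_def accum_accum)
  qed
  thus ?thesis by (simp add: f_def accum_zero)
qed

text \<open>The 3 counts the read of the old entry, the addition and the write. The 10 in all loop
  bounds is exact for the inverse square root, where e costs 7; the other two loops stay below
  it.\<close>

lemma runs_accum_Assign:
  assumes "has_ival E sl k" "has_ival E i u" "has_ival E j v" and A: "A \<in> carrier_mat p r" "u < p" "v < r"
    and "ncost e + 3 \<le> t" "t \<le> q" and "has_nval E (m((a, k) \<mapsto> A)) e x"
  shows "runs E (m((a, k) \<mapsto> A)) (Assign (a, sl) i j (NAdd (NCell (a, sl) i j) e))
    (m((a, k) \<mapsto> accum A (\<lambda>ij. if ij = (u, v) then x else 0))) t"
proof -
  have "update_mat A (u, v) (A $$ (u, v) + x) = accum A (\<lambda>ij. if ij = (u, v) then x else 0)"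
    using A by (intro eq_matI) (auto simp: accum_def update_mat_def)
  thus ?thesis
    using assms by (auto simp: runs_def has_ival_def has_nval_def address_def charge_def env_def in_bounds_def)
qed

end

text \<open>
  The matrices named 2, 3, 4, 5 hold \<open>R\<close>, its eigenvectors, its eigenvalues and \<open>R\<^sup>-\<^sup>1\<^sup>/\<^sup>2\<close>; the index
  variables 3 to 6 are loop counters.
\<close>

definition gram_loop :: com where
  "gram_loop = For 3 (IVar 2) (For 4 (IVar 0) (For 5 (IVar 0) (For 6 (IVar 1)
     (Assign (2, IConst 0) (IVar 4) (IVar 5) (NAdd (NCell (2, IConst 0) (IVar 4) (IVar 5))
       (NMul (NConj (NCell (0, IVar 3) (IVar 6) (IVar 4))) (NCell (0, IVar 3) (IVar 6) (IVar 5))))))))"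

text \<open>Dividing inside the innermost sum merges the diagonal factor with the product by
  \<open>U\<^sup>\<dagger>\<close>, so one triple loop and one new matrix suffice.\<close>

definition inv_sqrt_loop :: com where
  "inv_sqrt_loop = For 4 (IVar 0) (For 5 (IVar 0) (For 6 (IVar 0)
     (Assign (5, IConst 0) (IVar 4) (IVar 5) (NAdd (NCell (5, IConst 0) (IVar 4) (IVar 5))
       (NDiv (NMul (NCell (3, IConst 0) (IVar 4) (IVar 6)) (NConj (NCell (3, IConst 0) (IVar 5) (IVar 6))))
         (NSqrt (NCell (4, IConst 0) (IVar 6) (IConst 0))))))))"

definition product_loop :: com where
  "product_loop = For 3 (IVar 2) (Seq (New (1, IVar 3) (IVar 1) (IVar 0))
     (For 4 (IVar 1) (For 5 (IVar 0) (For 6 (IVar 0)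
       (Assign (1, IVar 3) (IVar 4) (IVar 5) (NAdd (NCell (1, IVar 3) (IVar 4) (IVar 5))
         (NMul (NCell (0, IVar 3) (IVar 4) (IVar 6)) (NCell (5, IConst 0) (IVar 6) (IVar 5)))))))))"

definition normalize_program :: com where
  "normalize_program =
    Seq (New (2, IConst 0) (IVar 0) (IVar 0))
    (Seq gram_loop
    (Seq (Eig (2, IConst 0) (3, IConst 0) (4, IConst 0))
    (Seq (New (5, IConst 0) (IVar 0) (IVar 0))
    (Seq inv_sqrt_loop product_loop))))"

section \<open>Correctness and running time of the loops\<close>

context machine
begin

text \<open>All Kraus operators are accumulated directly into R; storing the r separate products
  would take r m^2 cells.\<close>

lemma runs_gram_loop:
  assumes pos [simp]: "0 < m" "0 < n" "0 < r" and q [simp]: "10 \<le> q"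
    and K: "\<And>i. i < r \<Longrightarrow> K i \<in> carrier_mat n m" and st: "\<And>i. i < r \<Longrightarrow> st (0, i) = Some (K i)"
  shows "runs [(0, m), (1, n), (2, r)] (st((2, 0) \<mapsto> 0\<^sub>m m m)) gram_loop (st((2, 0) \<mapsto> kraus_R m r K))
    (3 * r * (3 * m * (3 * m * (3 * n * 10))))"
proof -
  note [simp] = has_ival carrier_matD[OF K] st
  have "runs [(0, m), (1, n), (2, r)] (st((2, 0) \<mapsto> 0\<^sub>m m m)) gram_loop
    (st((2, 0) \<mapsto> accum (0\<^sub>m m m) (\<lambda>ij. \<Sum>k<r. \<Sum>a<m. \<Sum>b<m. \<Sum>c<n.
      if ij = (a, b) then cnj (K k $$ (c, a)) * K k $$ (c, b) else 0)))
    (3 * r * (3 * m * (3 * m * (3 * n * 10))))"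
    unfolding gram_loop_def
    \<comment> \<open>Each repetition opens one loop and strips one sum from the stated increment,
      until the assignment is left.\<close>
    apply (rule runs_accum_For[where p = m and r = m], simp, simp, simp, simp, simp, (assumption | simp))+
    apply (rule runs_accum_Assign[where p = m and r = m], simp, simp, simp, assumption, simp, simp, simp, simp)
    apply (intro has_nval_mul has_nval_conj has_nval_cell)
    apply ((rule has_ival_var, simp) | simp)+
    done
  also have "accum (0\<^sub>m m m) (\<lambda>ij. \<Sum>k<r. \<Sum>a<m. \<Sum>b<m. \<Sum>c<n.
      if ij = (a, b) then cnj (K k $$ (c, a)) * K k $$ (c, b) else 0) = kraus_R m r K" (is "?L = ?R")
  proof (rule eq_matI)
    fix i j assume "i < dim_row ?R" "j < dim_col ?R"
    hence ij: "i < m" "j < m" by simp_all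
    \<comment> \<open>Splitting the test on the pair lets the sums over a and b collapse
      separately.\<close>
    have "?L $$ (i, j) = (\<Sum>k<r. \<Sum>a<m. \<Sum>b<m. \<Sum>c<n. if i = a then if j = b then
        cnj (K k $$ (c, a)) * K k $$ (c, b) else 0 else 0)"
      using ij by (auto simp: accum_def intro!: sum.cong)
    thus "?L $$ (i, j) = ?R $$ (i, j)" using ij by (simp add: kraus_R_index[OF K] sum_if_const)
  qed (simp_all add: accum_def)
  finally show ?thesis .
qed

lemma runs_inv_sqrt_loop:
  assumes pos [simp]: "0 < m" and q [simp]: "10 \<le> q"
    and A: "A \<in> carrier_mat m m" and Ul: "spectral_decomp A U l" and l: "\<And>i. i < m \<Longrightarrow> 0 < l $ i"
    and st [simp]: "st (3, 0) = Some U" "st (4, 0) = Some (column_mat l)"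
  shows "runs [(0, m), (1, n), (2, r)] (st((5, 0) \<mapsto> 0\<^sub>m m m)) inv_sqrt_loop (st((5, 0) \<mapsto> inv_sqrt_mat A))
    (3 * m * (3 * m * (3 * m * 10)))"
proof -
  note U = spectral_decompD(1)[OF Ul A]
  have [simp]: "dim_row U = m" "dim_col U = m" "dim_vec l = m"
    using U spectral_decompD(3)[OF Ul A] by auto
  note [simp] = has_ival l
  have "runs [(0, m), (1, n), (2, r)] (st((5, 0) \<mapsto> 0\<^sub>m m m)) inv_sqrt_loop
    (st((5, 0) \<mapsto> accum (0\<^sub>m m m) (\<lambda>ij. \<Sum>a<m. \<Sum>b<m. \<Sum>c<m.
      if ij = (a, b) then U $$ (a, c) * cnj (U $$ (b, c)) / complex_of_real (sqrt (l $ c)) else 0)))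
    (3 * m * (3 * m * (3 * m * 10)))"
    unfolding inv_sqrt_loop_def
    apply (rule runs_accum_For[where p = m and r = m], simp, simp, simp, simp, simp, (assumption | simp))+
    apply (rule runs_accum_Assign[where p = m and r = m], simp, simp, simp, assumption, simp, simp, simp, simp)
    apply (intro has_nval_div_sqrt has_nval_column has_nval_mul has_nval_conj has_nval_cell)
    apply ((rule has_ival_var, simp) | (rule has_ival_const) | simp)+
    done
  also have "accum (0\<^sub>m m m) (\<lambda>ij. \<Sum>a<m. \<Sum>b<m. \<Sum>c<m.
      if ij = (a, b) then U $$ (a, c) * cnj (U $$ (b, c)) / complex_of_real (sqrt (l $ c)) else 0) =
    U * mat_diag m (\<lambda>i. complex_of_real (1 / sqrt (l $ i))) * mat_adjoint U" (is "?L = ?R")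
  proof (rule eq_matI)
    fix i j assume "i < dim_row ?R" "j < dim_col ?R"
    hence ij: "i < m" "j < m" by simp_all
    have "?L $$ (i, j) = (\<Sum>a<m. \<Sum>b<m. \<Sum>c<m. if i = a then if j = b then
        U $$ (a, c) * cnj (U $$ (b, c)) / complex_of_real (sqrt (l $ c)) else 0 else 0)"
      using ij by (auto simp: accum_def intro!: sum.cong)
    thus "?L $$ (i, j) = ?R $$ (i, j)"
      using ij U by (simp add: unitary_diag_index sum_if_const del: index_mult_mat)
  qed (simp_all add: accum_def)
  also have "?R = inv_sqrt_mat A"
    using herm_fun_eq[OF Ul] A by (simp add: inv_sqrt_mat_def)
  finally show ?thesis .
qed

text \<open>The outer loop creates a matrix per iteration and is thus not an accumulation; it is
  described by the stores \<open>f k\<close> reached after k iterations.\<close>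

lemma runs_product_loop:
  assumes pos [simp]: "0 < m" "0 < n" "0 < r" and q [simp]: "10 \<le> q"
    and K: "\<And>i. i < r \<Longrightarrow> K i \<in> carrier_mat n m" and G: "G \<in> carrier_mat m m"
    and st0: "\<And>i. i < r \<Longrightarrow> st (0, i) = Some (K i)" and st5: "st (5, 0) = Some G"
    and st1: "\<And>i. st (1, i) = None"
  shows "runs [(0, m), (1, n), (2, r)] st product_loop
    (\<lambda>(a, i). if a = 1 \<and> i < r then Some (K i * G) else st (a, i))
    (3 * r * ((n * m + 1) + 3 * n * (3 * m * (3 * m * 10))))"
proof -
  define f where "f k = (\<lambda>(a, i). if a = 1 \<and> i < k then Some (K i * G) else st (a, i))" for k :: nat
  have f0: "f 0 = st" by (auto simp: f_def)
  have f_Suc: "f (Suc k) = (f k)((1, k) \<mapsto> K k * G)" for k by (auto simp: f_def)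
  note [simp] = has_ival carrier_matD[OF K] carrier_matD[OF G]
  have body: "runs [(3, k), (0, m), (1, n), (2, r)] (f k) (Seq (New (1, IVar 3) (IVar 1) (IVar 0))
     (For 4 (IVar 1) (For 5 (IVar 0) (For 6 (IVar 0)
       (Assign (1, IVar 3) (IVar 4) (IVar 5) (NAdd (NCell (1, IVar 3) (IVar 4) (IVar 5))
         (NMul (NCell (0, IVar 3) (IVar 4) (IVar 6)) (NCell (5, IConst 0) (IVar 6) (IVar 5)))))))))
     (f (Suc k)) ((n * m + 1) + 3 * n * (3 * m * (3 * m * 10)))" if k [simp]: "k < r" for k
  proof (rule runs_Seq)
    have fk [simp]: "f k (0, k) = Some (K k)" "f k (5, 0) = Some G" "f k (1, k) = None"
      by (simp_all add: f_def st0 st1 st5 del: One_nat_def)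
    show "runs [(3, k), (0, m), (1, n), (2, r)] (f k) (New (1, IVar 3) (IVar 1) (IVar 0))
        ((f k)((1, k) \<mapsto> 0\<^sub>m n m)) (n * m + 1)"
      using fk(3) by (intro runs_New) simp_all
    have "runs [(3, k), (0, m), (1, n), (2, r)] ((f k)((1, k) \<mapsto> 0\<^sub>m n m))
       (For 4 (IVar 1) (For 5 (IVar 0) (For 6 (IVar 0)
         (Assign (1, IVar 3) (IVar 4) (IVar 5) (NAdd (NCell (1, IVar 3) (IVar 4) (IVar 5))
           (NMul (NCell (0, IVar 3) (IVar 4) (IVar 6)) (NCell (5, IConst 0) (IVar 6) (IVar 5))))))))
       ((f k)((1, k) \<mapsto> accum (0\<^sub>m n m) (\<lambda>ij. \<Sum>a<n. \<Sum>b<m. \<Sum>c<m.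
         if ij = (a, b) then K k $$ (a, c) * G $$ (c, b) else 0)))
       (3 * n * (3 * m * (3 * m * 10)))"
      apply (rule runs_accum_For[where p = n and r = m], simp, simp, simp, simp, simp, (assumption | simp))+
      apply (rule runs_accum_Assign[where p = n and r = m], simp, simp, simp, assumption, simp, simp, simp, simp)
      apply (intro has_nval_mul has_nval_cell)
      apply ((rule has_ival_var, simp) | (rule has_ival_const) | simp)+
      done
    also have "accum (0\<^sub>m n m) (\<lambda>ij. \<Sum>a<n. \<Sum>b<m. \<Sum>c<m.
         if ij = (a, b) then K k $$ (a, c) * G $$ (c, b) else 0) = K k * G" (is "?L = ?R")
    proof (rule eq_matI)
      fix i j assume "i < dim_row ?R" "j < dim_col ?R"
      hence ij: "i < n" "j < m" by simp_all
      have "?L $$ (i, j) = (\<Sum>a<n. \<Sum>b<m. \<Sum>c<m. if i = a then if j = b then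
          K k $$ (a, c) * G $$ (c, b) else 0 else 0)"
        using ij by (auto simp: accum_def intro!: sum.cong)
      thus "?L $$ (i, j) = ?R $$ (i, j)"
        using ij by (simp add: mat_mult_index[OF K[OF k] G] sum_if_const del: index_mult_mat)
    qed (simp_all add: accum_def)
    finally show "runs [(3, k), (0, m), (1, n), (2, r)] ((f k)((1, k) \<mapsto> 0\<^sub>m n m))
       (For 4 (IVar 1) (For 5 (IVar 0) (For 6 (IVar 0)
         (Assign (1, IVar 3) (IVar 4) (IVar 5) (NAdd (NCell (1, IVar 3) (IVar 4) (IVar 5))
           (NMul (NCell (0, IVar 3) (IVar 4) (IVar 6)) (NCell (5, IConst 0) (IVar 6) (IVar 5))))))))
       (f (Suc k)) (3 * n * (3 * m * (3 * m * 10)))"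
      by (simp only: f_Suc)
  qed
  have "runs [(0, m), (1, n), (2, r)] (f 0) product_loop (f r)
    (3 * r * ((n * m + 1) + 3 * n * (3 * m * (3 * m * 10))))"
    unfolding product_loop_def
    by (rule runs_For) (use body in simp_all)
  thus ?thesis unfolding f0 unfolding f_def .
qed

lemma runs_normalize_program:
  fixes K m n r
  defines "R \<equiv> kraus_R m r K" and "st \<equiv> (\<lambda>(a, i). if a = 0 \<and> i < r then Some (K i) else None)"
  assumes pos: "0 < m" "0 < n" "0 < r" and q: "10 \<le> q" "M m \<le> q"
    and K: "\<And>i. i < r \<Longrightarrow> K i \<in> carrier_mat n m" and R: "pos_def_mat R"
    and Ul: "eig R = (U, l)" "spectral_decomp R U l"
  shows "runs [(0, m), (1, n), (2, r)] st normalize_program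
    (\<lambda>(a, i). if a = 1 \<and> i < r then Some (normalized_kraus m r K i)
      else (st((2, 0) \<mapsto> R, (3, 0) \<mapsto> U, (4, 0) \<mapsto> column_mat l, (5, 0) \<mapsto> inv_sqrt_mat R)) (a, i))
    ((m * m + 1) + (3 * r * (3 * m * (3 * m * (3 * n * 10))) + (T m + ((m * m + 1) +
      (3 * m * (3 * m * (3 * m * 10)) + 3 * r * ((n * m + 1) + 3 * n * (3 * m * (3 * m * 10))))))))"
  unfolding normalize_program_def
proof (intro runs_Seq)
  have Rc: "R \<in> carrier_mat m m" by (simp add: R_def)
  note [simp] = has_ival
  show "runs [(0, m), (1, n), (2, r)] st (New (2, IConst 0) (IVar 0) (IVar 0)) (st((2, 0) \<mapsto> 0\<^sub>m m m)) (m * m + 1)"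
    by (rule runs_New) (simp_all add: st_def)
  show "runs [(0, m), (1, n), (2, r)] (st((2, 0) \<mapsto> 0\<^sub>m m m)) gram_loop (st((2, 0) \<mapsto> R))
      (3 * r * (3 * m * (3 * m * (3 * n * 10))))"
    unfolding R_def using pos q K by (intro runs_gram_loop) (simp_all add: st_def)
  have "runs [(0, m), (1, n), (2, r)] (st((2, 0) \<mapsto> R)) (Eig (2, IConst 0) (3, IConst 0) (4, IConst 0))
      ((st((2, 0) \<mapsto> R))((3, 0) \<mapsto> U, (4, 0) \<mapsto> column_mat l)) (T (dim_row R))"
    using q pos_def_hermitian[OF R] Rc Ul by (intro runs_Eig) (simp_all add: st_def)
  thus "runs [(0, m), (1, n), (2, r)] (st((2, 0) \<mapsto> R)) (Eig (2, IConst 0) (3, IConst 0) (4, IConst 0))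
      (st((2, 0) \<mapsto> R, (3, 0) \<mapsto> U, (4, 0) \<mapsto> column_mat l)) (T m)"
    using Rc by simp
  show "runs [(0, m), (1, n), (2, r)] (st((2, 0) \<mapsto> R, (3, 0) \<mapsto> U, (4, 0) \<mapsto> column_mat l))
      (New (5, IConst 0) (IVar 0) (IVar 0))
      (st((2, 0) \<mapsto> R, (3, 0) \<mapsto> U, (4, 0) \<mapsto> column_mat l, (5, 0) \<mapsto> 0\<^sub>m m m)) (m * m + 1)"
    by (rule runs_New) (simp_all add: st_def)
  show "runs [(0, m), (1, n), (2, r)]
      (st((2, 0) \<mapsto> R, (3, 0) \<mapsto> U, (4, 0) \<mapsto> column_mat l, (5, 0) \<mapsto> 0\<^sub>m m m)) inv_sqrt_loop
      (st((2, 0) \<mapsto> R, (3, 0) \<mapsto> U, (4, 0) \<mapsto> column_mat l, (5, 0) \<mapsto> inv_sqrt_mat R))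
      (3 * m * (3 * m * (3 * m * 10)))"
    using pos q pos_def_eigenvalue_pos[OF R Rc Ul(2)]
    by (intro runs_inv_sqrt_loop[OF _ _ Rc Ul(2)]) simp_all
  show "runs [(0, m), (1, n), (2, r)]
      (st((2, 0) \<mapsto> R, (3, 0) \<mapsto> U, (4, 0) \<mapsto> column_mat l, (5, 0) \<mapsto> inv_sqrt_mat R)) product_loop
      (\<lambda>(a, i). if a = 1 \<and> i < r then Some (normalized_kraus m r K i)
        else (st((2, 0) \<mapsto> R, (3, 0) \<mapsto> U, (4, 0) \<mapsto> column_mat l, (5, 0) \<mapsto> inv_sqrt_mat R)) (a, i))
      (3 * r * ((n * m + 1) + 3 * n * (3 * m * (3 * m * 10))))"
    unfolding normalized_kraus_def R_def[symmetric]
    using pos q K inv_sqrt_mat(1)[OF R Rc] by (intro runs_product_loop) (simp_all add: st_def)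
qed

end

section \<open>Contents of the final store\<close>

text \<open>The 7 stands for the index variables 0 to 6. Inputs and outputs account for the 2 r
  matrices, and R, its eigenvectors and the inverse square root for the three square ones.\<close>

lemma memory_normalize_store:
  fixes K L :: "nat \<Rightarrow> complex mat" and m n r :: nat
  defines "st \<equiv> (\<lambda>(a, i). if a = 0 \<and> i < r then Some (K i) else None)"
  assumes K: "\<And>i. i < r \<Longrightarrow> K i \<in> carrier_mat n m" and L: "\<And>i. i < r \<Longrightarrow> L i \<in> carrier_mat n m"
    and RUG: "R \<in> carrier_mat m m" "U \<in> carrier_mat m m" "G \<in> carrier_mat m m" and w: "w \<in> carrier_mat m 1"
    and st': "store s = (\<lambda>(a, i). if a = 1 \<and> i < r then Some (L i)
      else (st((2, 0) \<mapsto> R, (3, 0) \<mapsto> U, (4, 0) \<mapsto> w, (5, 0) \<mapsto> G)) (a, i))"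
    and idx: "dom (idx s) \<subseteq> {..6}"
  shows "memory s \<le> 7 + (2 * r * (n * m) + 3 * (m * m) + m) + scratch s"
    and "A \<in> ran (store s) \<Longrightarrow> A \<in> carrier_mat n m \<or> A \<in> carrier_mat m m \<or> A \<in> carrier_mat m 1"
proof -
  let ?size = "\<lambda>k. dim_row (the (store s k)) * dim_col (the (store s k))"
  have dom: "dom (store s) = Pair 0 ` {..<r} \<union> (Pair 1 ` {..<r} \<union> {(2, 0), (3, 0), (4, 0), (5, 0)})"
    by (auto simp: st' st_def split: if_splits)
  have "sum ?size (Pair 0 ` {..<r}) = (\<Sum>i<r. n * m)"
    by (subst sum.reindex) (auto simp: inj_on_def st' st_def carrier_matD[OF K])
  moreover have "sum ?size (Pair 1 ` {..<r}) = (\<Sum>i<r. n * m)"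
    by (subst sum.reindex) (auto simp: inj_on_def st' carrier_matD[OF L])
  moreover have "sum ?size {(2, 0), (3, 0), (4, 0), (5, 0)} = 3 * (m * m) + m"
    using RUG w by (auto simp: st')
  moreover have "sum ?size (dom (store s)) = sum ?size (Pair 0 ` {..<r}) +
      (sum ?size (Pair 1 ` {..<r}) + sum ?size {(2, 0), (3, 0), (4, 0), (5, 0)})"
    unfolding dom by (subst sum.union_disjoint, simp, simp, force, subst sum.union_disjoint, simp, simp, force) (rule refl)
  ultimately have "sum ?size (dom (store s)) = 2 * r * (n * m) + 3 * (m * m) + m"
    by (simp only: sum_constant card_lessThan) simp
  moreover have "card (dom (idx s)) \<le> 7"
    using card_mono[OF _ idx] by simp
  ultimately show "memory s \<le> 7 + (2 * r * (n * m) + 3 * (m * m) + m) + scratch s"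
    by (simp add: memory_def)
  show "A \<in> ran (store s) \<Longrightarrow> A \<in> carrier_mat n m \<or> A \<in> carrier_mat m m \<or> A \<in> carrier_mat m 1"
    using K L RUG w by (auto simp: ran_def st' st_def split: if_splits)
qed

section \<open>Cost of the normalization\<close>

text \<open>Without Kraus operators R would vanish, which a positive definite matrix of dimension m
  > 0 cannot do.\<close>

lemma kraus_instance_pos:
  assumes "kraus_instance m n r K \<Theta>"
  shows "0 < m" "0 < n" "0 < r"
proof -
  show m: "0 < m" and "0 < n" using assms by (auto simp: kraus_instance_def)
  show "0 < r"
  proof (rule ccontr)
    assume "\<not> 0 < r"
    hence "kraus_R m r K = 0\<^sub>m m m" by (intro eq_matI) (auto simp: kraus_R_def)
    moreover have "pos_def_mat (kraus_R m r K)" using assms by (simp add: kraus_instance_def)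
    moreover have "unit_vec m 0 \<noteq> (0\<^sub>v m :: complex vec)"
      using m by (metis index_unit_vec(1) index_zero_vec(1) zero_neq_one)
    ultimately have "(0 :: complex) < (0\<^sub>m m m *\<^sub>v unit_vec m 0) \<bullet>c unit_vec m 0"
      by (auto simp: pos_def_mat_def)
    moreover have "0\<^sub>m m m *\<^sub>v unit_vec m 0 = (0\<^sub>v m :: complex vec)"
      by (intro eq_vecI) simp_all
    ultimately show False by simp
  qed
qed

lemma normalize_program_cost:
  assumes "eigensolver eig T M"
  shows "\<exists>c. \<forall>m n r K \<Theta>. kraus_instance m n r K \<Theta> \<longrightarrow>
    (\<exists>s. exec eig T M normalize_program (input_state m n r K) = Some s \<and>
      output_is s r (normalized_kraus m r K) \<and>
      ops s \<le> c * (r * m ^ 2 * n + m ^ 3) \<and>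
      memory s \<le> c * (r * (m * n) + m ^ 2) \<and>
      (1 < n \<longrightarrow> (\<forall>A \<in> ran (store s). dim_row A * dim_col A < (m * n) * (m * n))))"
proof -
  obtain cT cM where cT: "\<And>d. 0 < d \<Longrightarrow> T d \<le> cT * d ^ 3" and cM: "\<And>d. 0 < d \<Longrightarrow> M d \<le> cM * d ^ 2"
    using assms bigo_power_bound[of T 3] bigo_power_bound[of M 2] unfolding eigensolver_def by metis
  show ?thesis
  \<comment> \<open>2000 is a round number above the coefficients 1626 and 274 for operations and 2
    and 21 for memory found below.\<close>
  proof (intro exI[of _ "2000 + cT + cM"] allI impI)
    fix m n r K \<Theta>
    assume inst: "kraus_instance m n r K \<Theta>"
    note pos = kraus_instance_pos[OF inst]
    have K: "K i \<in> carrier_mat n m" if "i < r" for i using inst that by (simp add: kraus_instance_def)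
    define R where "R = kraus_R m r K"
    have R: "pos_def_mat R" "R \<in> carrier_mat m m" using inst by (simp_all add: R_def kraus_instance_def)
    obtain U l where Ul: "eig R = (U, l)" by force
    have dec: "spectral_decomp R U l"
      using assms pos_def_hermitian[OF R(1)] Ul unfolding eigensolver_def by (metis case_prod_conv)
    define st where "st = (\<lambda>(a, i). if a = (0::nat) \<and> i < r then Some (K i) else None)"
    \<comment> \<open>Scratch space: 10 for the largest assignment, \<open>M m\<close> for the
      eigendecomposition.\<close>
    interpret machine eig T M "10 + M m" .
    have env: "env [(0, m), (1, n), (2, r)] (input_state m n r K)"
      by (auto simp: env_def input_state_def split: if_splits)
    obtain s where s: "exec eig T M normalize_program (input_state m n r K) = Some s"
      "env [(0, m), (1, n), (2, r)] s"
      "store s = (\<lambda>(a, i). if a = 1 \<and> i < r then Some (normalized_kraus m r K i)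
        else (st((2, 0) \<mapsto> R, (3, 0) \<mapsto> U, (4, 0) \<mapsto> column_mat l, (5, 0) \<mapsto> inv_sqrt_mat R)) (a, i))"
      "scratch s \<le> 10 + M m"
      "ops s \<le> ops (input_state m n r K) +
        ((m * m + 1) + (3 * r * (3 * m * (3 * m * (3 * n * 10))) + (T m + ((m * m + 1) +
        (3 * m * (3 * m * (3 * m * 10)) + 3 * r * ((n * m + 1) + 3 * n * (3 * m * (3 * m * 10))))))))"
      using runsE[OF runs_normalize_program[OF pos _ _ K R(1)[unfolded R_def] Ul[unfolded R_def] dec[unfolded R_def]] env]
      unfolding R_def st_def by (auto simp: input_state_def)
    have U: "U \<in> carrier_mat m m" "l \<in> carrier_vec m" using spectral_decompD[OF dec R(2)] by auto
    have L: "normalized_kraus m r K i \<in> carrier_mat n m" if "i < r" for i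
      using normalized_kraus_carrier K[OF that] R(1) unfolding R_def by blast
    have w: "column_mat l \<in> carrier_mat m 1" using U by (auto simp: column_mat_def)
    note mem = memory_normalize_store[OF K L R(2) U(1) inv_sqrt_mat(1)[OF R] w s(3)[unfolded st_def]]
    have idx: "dom (idx s) \<subseteq> {..6}" using s(2) by (simp add: env_def)
    have m1: "1 \<le> m ^ 2" "m \<le> m ^ 2" "1 \<le> m ^ 3" "m ^ 2 \<le> m ^ 3"
      using pos power_increasing[of 1 2 m] power_increasing[of 2 3 m] by simp_all
    have X: "r \<le> r * m ^ 2 * n" "r * (n * m) \<le> r * m ^ 2 * n"
      using pos by (simp_all add: power2_eq_square)
    have "ops s \<le> (2000 + cT) * (r * m ^ 2 * n + m ^ 3)"
    proof -
      \<comment> \<open>1620 is twice 3^4 * 10, from the two fourfold loop nests; 270 is 3^3 * 10,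
        from the threefold one.\<close>
      have "ops s \<le> 2 * (m ^ 2 + 1) + 1620 * (r * m ^ 2 * n) + T m + 270 * m ^ 3 + 3 * r + 3 * (r * (n * m))"
        using s(5) by (simp add: input_state_def algebra_simps power2_eq_square power3_eq_cube)
      also have "\<dots> \<le> 1626 * (r * m ^ 2 * n) + cT * m ^ 3 + 274 * m ^ 3"
      proof -
        \<comment> \<open>Abstracting the monomials leaves a linear problem.\<close>
        have "2 * (a + 1) + 1620 * x + t + 270 * b + 3 * r + 3 * y \<le> 1626 * x + z + 274 * b"
          if "1 \<le> b" "a \<le> b" "r \<le> x" "y \<le> x" "t \<le> z" for a b x y z t :: nat
          using that by presburger
        thus ?thesis using m1 X cT[OF pos(1)] by blast
      qed
      also have "\<dots> \<le> (2000 + cT) * (r * m ^ 2 * n) + (2000 + cT) * m ^ 3"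
        by (simp add: algebra_simps)
      finally show ?thesis by (simp add: algebra_simps)
    qed
    hence "ops s \<le> (2000 + cT + cM) * (r * m ^ 2 * n + m ^ 3)"
      by (rule order_trans) (intro mult_right_mono; simp)
    moreover have "memory s \<le> (2000 + cT + cM) * (r * (m * n) + m ^ 2)"
    proof -
      have "memory s \<le> 17 + 2 * (r * (m * n)) + 3 * m ^ 2 + m + M m"
        using mem(1)[OF _ _ idx] s(4) by (simp add: algebra_simps power2_eq_square)
      also have "\<dots> \<le> 2 * (r * (m * n)) + (21 + cM) * m ^ 2"
        using m1 cM[OF pos(1)] by (simp add: algebra_simps)
      also have "\<dots> \<le> (2000 + cT + cM) * (r * (m * n)) + (2000 + cT + cM) * m ^ 2"
        by (intro add_mono mult_right_mono) simp_all
      finally show ?thesis by (simp add: algebra_simps)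
    qed
    \<comment> \<open>For n = 1 the inequality fails, as R itself is then of size
      \<open>m * n\<close> by \<open>m * n\<close>.\<close>
    moreover have "dim_row A * dim_col A < (m * n) * (m * n)" if n: "1 < n" and A: "A \<in> ran (store s)" for A
    proof -
      have "n \<le> m * n" "n \<le> n * n" using pos by simp_all
      hence "1 < m * n" "1 < n * n" using n by linarith+
      hence size: "m * n < (m * n) * (m * n)" "m * m < (m * n) * (m * n)"
        using pos by simp_all
      moreover have "m \<le> m * m" by simp
      ultimately have "m < (m * n) * (m * n)" by linarith
      moreover have "dim_row A * dim_col A = m * n \<or> dim_row A * dim_col A = m * m \<or> dim_row A * dim_col A = m"
        using mem(2)[OF _ _ idx A] by (auto simp: mult.commute)
      ultimately show ?thesis by (elim disjE) (simp_all only: size)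
    qed
    moreover have "output_is s r (normalized_kraus m r K)" by (simp add: output_is_def s(3))
    ultimately show "\<exists>s. exec eig T M normalize_program (input_state m n r K) = Some s \<and>
      output_is s r (normalized_kraus m r K) \<and>
      ops s \<le> (2000 + cT + cM) * (r * m ^ 2 * n + m ^ 3) \<and>
      memory s \<le> (2000 + cT + cM) * (r * (m * n) + m ^ 2) \<and>
      (1 < n \<longrightarrow> (\<forall>A \<in> ran (store s). dim_row A * dim_col A < (m * n) * (m * n)))"
      using s(1) by blast
  qed
qed

text \<open>The quantifier order carries the content: P precedes the solver and all dimensions, so
  nothing can be hard-coded, and c may depend on the solver but not on the instance.\<close>

theorem theorem5:
  shows
    "(\<forall>dA dB r K \<Theta>. kraus_instance dA dB r K \<Theta> \<longrightarrow>
        quantum_channel dA dB (kraus_map dB r (normalized_kraus dA r K)) \<and>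
        fidelity_projection dA dB (choi dA dB \<Theta>) =
          choi dA dB (kraus_map dB r (normalized_kraus dA r K)))
     \<and>
     (\<exists>P. \<forall>eig T M. eigensolver eig T M \<longrightarrow>
        (\<exists>c. \<forall>dA dB r K \<Theta>. kraus_instance dA dB r K \<Theta> \<longrightarrow>
           (\<exists>s. exec eig T M P (input_state dA dB r K) = Some s \<and>
                output_is s r (normalized_kraus dA r K) \<and>
                ops s \<le> c * (r * dA ^ 2 * dB + dA ^ 3) \<and>
                memory s \<le> c * (r * (dA * dB) + dA ^ 2) \<and>
                (1 < dB \<longrightarrow>
                   (\<forall>A \<in> ran (store s). dim_row A * dim_col A < (dA * dB) * (dA * dB))))))"
proof (rule conjI)
  show "\<forall>dA dB r K \<Theta>. kraus_instance dA dB r K \<Theta> \<longrightarrow>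
      quantum_channel dA dB (kraus_map dB r (normalized_kraus dA r K)) \<and>
      fidelity_projection dA dB (choi dA dB \<Theta>) = choi dA dB (kraus_map dB r (normalized_kraus dA r K))"
  proof (intro allI impI)
    fix dA dB r K \<Theta>
    assume "kraus_instance dA dB r K \<Theta>"
    hence dA: "0 < dA" and K: "\<And>i. i < r \<Longrightarrow> K i \<in> carrier_mat dB dA"
      and \<Theta>: "\<And>\<sigma>. \<sigma> \<in> carrier_mat dA dA \<Longrightarrow> \<Theta> \<sigma> = kraus_map dB r K \<sigma>"
      and R: "pos_def_mat (kraus_R dA r K)"
      by (simp_all add: kraus_instance_def)
    have "choi dA dB \<Theta> = choi dA dB (kraus_map dB r K)"
      by (rule choi_cong) (rule \<Theta>)
    thus "quantum_channel dA dB (kraus_map dB r (normalized_kraus dA r K)) \<and>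
        fidelity_projection dA dB (choi dA dB \<Theta>) = choi dA dB (kraus_map dB r (normalized_kraus dA r K))"
      using quantum_channel_normalized_kraus[OF K R] fidelity_projection_choi_kraus[OF K R dA] by simp
  qed
qed (rule exI[of _ normalize_program], intro allI impI, rule normalize_program_cost)

end
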